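(* The clones $\langle\mathrm{End}(\mathbb{Q},<)\rangle$ and $\langle\mathrm{End}(\mathbb{Q},\le)\rangle$ on $\mathbb{Q}$ generated by the endomorphism monoids of $(\mathbb{Q},<)$ and $(\mathbb{Q},\le)$, respectively, both have automatic homeomorphicity.
   Context: For a set $A$, $\mathcal{O}_A$ is the set of all finitary operations $f\colon A^n\to A$, $n\ge 0$. A clone on $A$ is a subset of $\mathcal{O}_A$ closed under composition (whenever arities match) and containing all projections $\pi_i^{(n)}\colon A^n\to A$, $\pi_i^{(n)}(a_1,\dots,a_n)=a_i$ ($1\le i\le n$). For a clone $P$, $P^{(n)}$ is its set of $n$-ary members. For a monoid $E$ of maps $A\to A$, $\langle E\rangle$ denotes the least clone on $A$ containing $E$; explicitly $\langle E\rangle=\bigcup_{k\ge1}\{f\circ\pi_j^{(k)}\colon 1\le j\le k,\ f\in E\}$. A clone homomorphism is an arity-preserving map between clones that sends each projection $\pi_i^{(n)}$ to the projection $\pi_i^{(n)}$ and preserves composition. A clone isomorphism is a bijective clone homomorphism. The topology on a clone $P$ on $A$ has as sub-basic open sets all sets $\{f\in P^{(n)}\colon f(a_1,\dots,a_n)=b\}$ with $n\ge0$ and $a_1,\dots,a_n,b\in A$. A closed clone $P$ on a countable set has automatic homeomorphicity if every clone isomorphism from $P$ to a closed subclone of $\mathcal{O}_\Omega$, for any countable set $\Omega$, is a homeomorphism. $\mathrm{End}(\mathbb{Q},<)$ is the monoid of strictly order-preserving maps $\mathbb{Q}\to\mathbb{Q}$ and $\mathrm{End}(\mathbb{Q},\le)$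 the monoid of weakly order-preserving maps. *)

theory Defs
  imports "HOL-Analysis.Analysis" "HOL-Library.NList"
begin

text \<open>
  An operation on a carrier set is stored together with its arity, and its second component is
  extensional, i.e. \<open>undefined\<close> outside the tuples of that length over the carrier. Hence equality
  of operations is equality of arity and of the function on tuples. The arity cannot be dropped:
  on an empty carrier, the function alone does not determine it.
\<close>

type_synonym 'a op = "nat \<times> ('a list \<Rightarrow> 'a)"

abbreviation arity :: "'a op \<Rightarrow> nat" where
  "arity \<equiv> fst"

abbreviation app :: "'a op \<Rightarrow> 'a list \<Rightarrow> 'a" where
  "app \<equiv> snd"

definition all_ops :: "'a set \<Rightarrow> 'a op set" where
  "all_ops A = (SIGMA n:UNIV. nlists n A \<rightarrow>\<^sub>E A)"

text \<open>Projections are indexed from 0.\<close>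

definition proj_op :: "'a set \<Rightarrow> nat \<Rightarrow> nat \<Rightarrow> 'a op" where
  "proj_op A n i = (n, \<lambda>xs\<in>nlists n A. xs ! i)"

text \<open>
  The composite of \<open>f\<close> with the list \<open>gs\<close> of \<open>m\<close>-ary operations, meaningful if \<open>arity f = length gs\<close>.
  The arity \<open>m\<close> is an explicit argument because \<open>gs\<close> does not determine it when \<open>f\<close> is nullary.
\<close>

definition comp_op :: "'a set \<Rightarrow> nat \<Rightarrow> 'a op \<Rightarrow> 'a op list \<Rightarrow> 'a op" where
  "comp_op A m f gs = (m, \<lambda>xs\<in>nlists m A. app f (map (\<lambda>g. app g xs) gs))"

definition clone_on :: "'a set \<Rightarrow> 'a op set \<Rightarrow> bool" where
  "clone_on A P \<longleftrightarrow>
     P \<subseteq> all_ops A \<and>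
     (\<forall>n. \<forall>i<n. proj_op A n i \<in> P) \<and>
     (\<forall>m f gs. f \<in> P \<and> set gs \<subseteq> P \<and> arity f = length gs \<and> (\<forall>g\<in>set gs. arity g = m)
        \<longrightarrow> comp_op A m f gs \<in> P)"

definition unary_op :: "'a set \<Rightarrow> ('a \<Rightarrow> 'a) \<Rightarrow> 'a op" where
  "unary_op A e = (1, \<lambda>xs\<in>nlists 1 A. e (hd xs))"

text \<open>The least clone containing \<open>E\<close>, meaningful for sets \<open>E\<close> of maps from \<open>A\<close> to \<open>A\<close>.\<close>

definition generated_clone :: "'a set \<Rightarrow> ('a \<Rightarrow> 'a) set \<Rightarrow> 'a op set" where
  "generated_clone A E = \<Inter>{P. clone_on A P \<and> unary_op A ` E \<subseteq> P}"

definition clone_hom :: "'a set \<Rightarrow> 'a op set \<Rightarrow> 'b set \<Rightarrow> 'b op set \<Rightarrow> ('a op \<Rightarrow> 'b op) \<Rightarrow> bool" where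
  "clone_hom A P B Q h \<longleftrightarrow>
     h \<in> P \<rightarrow> Q \<and>
     (\<forall>f\<in>P. arity (h f) = arity f) \<and>
     (\<forall>n. \<forall>i<n. h (proj_op A n i) = proj_op B n i) \<and>
     (\<forall>m f gs. f \<in> P \<and> set gs \<subseteq> P \<and> arity f = length gs \<and> (\<forall>g\<in>set gs. arity g = m)
        \<longrightarrow> h (comp_op A m f gs) = comp_op B m (h f) (map h gs))"

definition clone_iso :: "'a set \<Rightarrow> 'a op set \<Rightarrow> 'b set \<Rightarrow> 'b op set \<Rightarrow> ('a op \<Rightarrow> 'b op) \<Rightarrow> bool" where
  "clone_iso A P B Q h \<longleftrightarrow> clone_hom A P B Q h \<and> bij_betw h P Q"

text \<open>
  The whole of \<open>P\<close> is added to the sub-basis since \<^const>\<open>topology_generated_by\<close> does not count the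
  empty intersection as open; this only matters when \<open>A\<close> is empty.
\<close>

definition clone_topology :: "'a set \<Rightarrow> 'a op set \<Rightarrow> 'a op topology" where
  "clone_topology A P =
     topology_generated_by
       (insert P {{f \<in> P. arity f = length as \<and> app f as = b} | as b. as \<in> lists A \<and> b \<in> A})"

definition closed_clone :: "'a set \<Rightarrow> 'a op set \<Rightarrow> bool" where
  "closed_clone A P \<longleftrightarrow> clone_on A P \<and> closedin (clone_topology A (all_ops A)) P"

text \<open>
  The type argument is the type in which the countable sets \<open>\<Omega>\<close> live. A statement about all countable
  sets leaves it as a free type variable.
\<close>

definition automatic_homeomorphicity :: "'b itself \<Rightarrow> 'a set \<Rightarrow> 'a op set \<Rightarrow> bool" where
  "automatic_homeomorphicity _ A P \<longleftrightarrow>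
     countable A \<and> closed_clone A P \<and>
     (\<forall>(\<Omega> :: 'b set) Q h. countable \<Omega> \<and> closed_clone \<Omega> Q \<and> clone_iso A P \<Omega> Q h
        \<longrightarrow> homeomorphic_map (clone_topology A P) (clone_topology \<Omega> Q) h)"

end

theory Submission
  imports Defs
begin

text \<open>
  Let \<open>E\<close> be the monoid of strictly monotone maps, or of monotone maps, and let it act faithfully on a
  countable set \<open>\<Omega>\<close> with closed image. There are uncountably many embeddings \<open>tree A\<close> of the rationals, so
  for each \<open>b \<in> \<Omega>\<close> two of them act equally on \<open>b\<close>. Composing both with a strictly monotone \<open>k\<close> from the left
  turns this pair into any pair \<open>f\<close>, \<open>g\<close> of the same joint order type, as long as the images leave
  enough room for \<open>k\<close> to exist. Hence tame maps (bounded, with isolated values) that agree on a certain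
  finite set act equally on \<open>b\<close>. Tame maps form a dense ideal of the strictly monotone maps, and
  closedness of the image carries continuity over to all of them. Closedness is essential: the action
  on two points that sends both to the second one exactly if the map is not surjective is discontinuous.

  For the clones, composition with a projection adds only the position of the argument, which
  finitely many tuples detect.
\<close>

section \<open>Extension of strictly monotone partial maps\<close>

text \<open>The obstacle is that \<open>k\<close> must be defined at every rational, not only on the
  images of the trees. At a cut of these images with no last point below and no first point above,
  the prescribed values may close up and leave no value for \<open>k\<close>. This shapes both
  sides: in the source no rational fills such a cut, and in the target bounded maps with isolated
  values leave room at every other cut. Two trees also have a special position: off the finitely
  many points where they agree, one lies below the other. Two tame maps that agree at these points
  may cross each other, so they are not compared directly; each is compared with a third map that
  lies above both. Continuity of the inverse isomorphism needs the opposite estimate: finitely many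
  values of the action determine the value of a map at a given rational. Strictly monotone maps
  obtain it from minimal supports, monotone maps from constants.\<close>

definition squash :: "rat \<Rightarrow> rat" where
  "squash x = 1 / 2 + x / (2 * (1 + \<bar>x\<bar>))"

lemma squash_bounds: "0 < squash x" "squash x < 1"
  by (auto simp: squash_def field_simps abs_if)

lemma strict_mono_squash: "strict_mono squash"
proof (rule strict_monoI)
  fix x y :: rat assume "x < y"
  have "x * (1 + \<bar>y\<bar>) < y * (1 + \<bar>x\<bar>)"
  proof (cases "0 \<le> x \<or> y \<le> 0")
    case True
    then show ?thesis using \<open>x < y\<close> by (auto simp: abs_if algebra_simps)
  next
    case False
    then have "x * (1 + \<bar>y\<bar>) < 0" "0 < y * (1 + \<bar>x\<bar>)"
      by (auto simp: mult_less_0_iff zero_less_mult_iff)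
    then show ?thesis by linarith
  qed
  then have "x / (1 + \<bar>x\<bar>) < y / (1 + \<bar>y\<bar>)"
    by (subst frac_less_eq) (auto simp: divide_less_0_iff mult_less_0_iff algebra_simps add_pos_nonneg)
  then show "squash x < squash y"
    using divide_strict_right_mono[of "x / (1 + \<bar>x\<bar>)" "y / (1 + \<bar>y\<bar>)" 2]
    by (simp add: squash_def mult.commute)
qed

text \<open>Points outside the image of \<open>t\<close> are sorted by the cut they make in it. All
  points of one cut share one interval, in which \<open>squash\<close> keeps their order; points of
  different cuts are separated by some \<open>v i\<close>. The index type allows several maps, with
  coincidences, to be prescribed at once.\<close>

lemma strict_mono_extension:
  fixes t v :: "'i \<Rightarrow> rat"
  assumes less: "\<And>i j. i \<in> I \<Longrightarrow> j \<in> I \<Longrightarrow> t i < t j \<Longrightarrow> v i < v j"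
    and eq: "\<And>i j. i \<in> I \<Longrightarrow> j \<in> I \<Longrightarrow> t i = t j \<Longrightarrow> v i = v j"
    and room: "\<And>z. z \<notin> t ` I \<Longrightarrow>
      \<exists>u w. u < w \<and> (\<forall>i\<in>I. t i < z \<longrightarrow> v i \<le> u) \<and> (\<forall>i\<in>I. z < t i \<longrightarrow> w \<le> v i)"
  obtains k where "strict_mono k" "\<And>i. i \<in> I \<Longrightarrow> k (t i) = v i"
proof -
  define cut where "cut z = {i \<in> I. t i < z}" for z
  define R where "R S p \<longleftrightarrow> fst p < snd p \<and> (\<forall>i\<in>S. v i \<le> fst p) \<and> (\<forall>i\<in>I - S. snd p \<le> v i)"
    for S and p :: "rat \<times> rat"
  \<comment> \<open>The interval depends on the cut alone and not on the point that makes it, so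
    that points of one gap can be ordered by \<open>squash\<close>.\<close>
  define g where "g S = (SOME p. R S p)" for S
  define idx where "idx z = (SOME i. i \<in> I \<and> t i = z)" for z
  define k where "k z = (if z \<in> t ` I then v (idx z)
    else fst (g (cut z)) + (snd (g (cut z)) - fst (g (cut z))) * squash z)" for z
  have g: "R (cut z) (g (cut z))" if z: "z \<notin> t ` I" for z
  proof -
    obtain u w where "u < w" "\<forall>i\<in>I. t i < z \<longrightarrow> v i \<le> u" "\<forall>i\<in>I. z < t i \<longrightarrow> w \<le> v i"
      using room[OF z] by blast
    then have "R (cut z) (u, w)"
      using z unfolding R_def cut_def by (force simp: not_less le_less)
    then show ?thesis unfolding g_def by (rule someI)
  qed
  have kv: "k (t i) = v i" if "i \<in> I" for i
  proof -
    have "\<exists>j. j \<in> I \<and> t j = t i" using that by blast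
    then have "idx (t i) \<in> I \<and> t (idx (t i)) = t i" unfolding idx_def by (rule someI_ex)
    then show ?thesis using eq[of "idx (t i)" i] that by (auto simp: k_def)
  qed
  have kgap: "fst (g (cut z)) < k z" "k z < snd (g (cut z))" if z: "z \<notin> t ` I" for z
  proof -
    define a b where "a = fst (g (cut z))" and "b = snd (g (cut z))"
    have "a < b" using g[OF z] by (auto simp: R_def a_def b_def)
    then have "0 < (b - a) * squash z" "(b - a) * squash z < (b - a) * 1"
      using squash_bounds[of z] by (auto intro!: mult_strict_left_mono)
    then show "fst (g (cut z)) < k z" "k z < snd (g (cut z))"
      using z by (auto simp: k_def a_def b_def)
  qed
  have "strict_mono k"
  proof (rule strict_monoI)
    fix y z :: rat assume yz: "y < z"
    show "k y < k z"
    proof (cases "y \<in> t ` I")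
      case y: True
      then obtain i where i: "i \<in> I" "y = t i" by blast
      show ?thesis
      proof (cases "z \<in> t ` I")
        case True
        then show ?thesis using i less yz kv by auto
      next
        case False
        have "i \<in> cut z" using i yz by (auto simp: cut_def)
        then show ?thesis using g[OF False] kgap[OF False] kv i unfolding R_def by force
      qed
    next
      case y: False
      show ?thesis
      proof (cases "z \<in> t ` I")
        case True
        then obtain i where i: "i \<in> I" "z = t i" by blast
        then have "i \<in> I - cut y" using yz by (auto simp: cut_def)
        then show ?thesis using g[OF y] kgap[OF y] kv i unfolding R_def by force
      next
        case z: False
        show ?thesis
        proof (cases "cut y = cut z")
          case True
          have "fst (g (cut z)) < snd (g (cut z))" using g[OF z] by (simp add: R_def)
          then show ?thesis using True y z yz strict_mono_squash
            by (simp add: k_def strict_mono_less)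
        next
          case False
          then obtain i where "i \<in> cut z" "i \<in> I - cut y" using yz by (force simp: cut_def)
          then have "k y < v i" "v i < k z"
            using g[OF y] kgap[OF y] g[OF z] kgap[OF z] unfolding R_def by force+
          then show ?thesis by simp
        qed
      qed
    qed
  qed
  then show thesis using kv that by blast
qed

lemma finite_sets_gap:
  fixes L U :: "rat set"
  assumes "finite L" "finite U" "\<And>l u. l \<in> L \<Longrightarrow> u \<in> U \<Longrightarrow> l < u"
  shows "\<exists>a b. a < b \<and> (\<forall>l\<in>L. l \<le> a) \<and> (\<forall>u\<in>U. b \<le> u)"
proof -
  define a where "a = (if L = {} then if U = {} then 0 else Min U - 1 else Max L)"
  define b where "b = (if U = {} then a + 1 else Min U)"
  have "a < b"
  proof (cases "L = {} \<or> U = {}")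
    case False
    then show ?thesis using assms by (simp add: a_def b_def)
  qed (auto simp: a_def b_def)
  moreover have "\<forall>l\<in>L. l \<le> a" "\<forall>u\<in>U. b \<le> u" using assms by (auto simp: a_def b_def)
  ultimately show ?thesis by blast
qed

text \<open>Finitely many values below a cut and finitely many above it always leave an interval
  between them.\<close>

lemma finite_strict_mono_extension:
  fixes t v :: "'i \<Rightarrow> rat"
  assumes "finite I"
    and less: "\<And>i j. i \<in> I \<Longrightarrow> j \<in> I \<Longrightarrow> t i < t j \<Longrightarrow> v i < v j"
    and eq: "\<And>i j. i \<in> I \<Longrightarrow> j \<in> I \<Longrightarrow> t i = t j \<Longrightarrow> v i = v j"
  obtains k where "strict_mono k" "\<And>i. i \<in> I \<Longrightarrow> k (t i) = v i"
proof (rule strict_mono_extension[of I t v])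
  fix z
  have "\<exists>u w. u < w \<and> (\<forall>l\<in>v ` {i \<in> I. t i < z}. l \<le> u) \<and> (\<forall>l\<in>v ` {i \<in> I. z < t i}. w \<le> l)"
  proof (rule finite_sets_gap)
    fix a b assume "a \<in> v ` {i \<in> I. t i < z}" "b \<in> v ` {i \<in> I. z < t i}"
    then obtain i j where "i \<in> I" "j \<in> I" "t i < z" "z < t j" "a = v i" "b = v j" by blast
    then show "a < b" using less[of i j] by simp
  qed (use \<open>finite I\<close> in simp_all)
  then obtain u w where "u < w" "\<forall>l\<in>v ` {i \<in> I. t i < z}. l \<le> u" "\<forall>l\<in>v ` {i \<in> I. z < t i}. w \<le> l"
    by blast
  then show "\<exists>u w. u < w \<and> (\<forall>i\<in>I. t i < z \<longrightarrow> v i \<le> u) \<and> (\<forall>i\<in>I. z < t i \<longrightarrow> w \<le> v i)"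
    by (intro exI[of _ u] exI[of _ w]) simp
qed (blast intro: less eq that)+

definition rat_enum :: "nat \<Rightarrow> rat" where "rat_enum = from_nat_into UNIV"

definition rat_rank :: "rat \<Rightarrow> nat" where "rat_rank = to_nat_on UNIV"

lemma enum_rat_rank [simp]: "rat_enum (rat_rank q) = q"
  by (simp add: rat_enum_def rat_rank_def countableI_type)

lemma rat_rank_enum [simp]: "rat_rank (rat_enum i) = i"
  by (simp add: rat_enum_def rat_rank_def countableI_type infinite_UNIV_char_0 to_nat_on_from_nat_into_infinite)

section \<open>A Cantor tree of embeddings\<close>

text \<open>
  \<open>tree A q\<close> encodes the path to \<open>q\<close> that compares \<open>q\<close> with \<open>rat_enum 0\<close>, \<open>rat_enum 1\<close> and so on until \<open>q\<close>
  is found; at step \<open>i\<close> the bit \<open>i \<in> A\<close> is read first and then the result of the comparison, so that the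
  embeddings \<open>tree A\<close> and \<open>tree B\<close> separate lexicographically at their first different bit. The quotients
  \<open>wt (Suc i) / wt i\<close> are unbounded, which makes the infinite expansions irrational: no rational number
  fills an irrational cut of the image.
\<close>

definition wt :: "nat \<Rightarrow> rat" where "wt i = 16 ^ i * fact i"

text \<open>The bit contributes 4 or -4 and the comparison at most 1 in absolute value, so the sign
  of a digit is decided by the bit.\<close>

definition digit :: "nat set \<Rightarrow> rat \<Rightarrow> nat \<Rightarrow> rat" where
  "digit A q i = 4 * (if i \<in> A then 1 else -1) + sgn (q - rat_enum i)"

definition tree_upto :: "nat set \<Rightarrow> rat \<Rightarrow> nat \<Rightarrow> rat" where
  "tree_upto A q n = (\<Sum>i<n. digit A q i / wt i)"

text \<open>The bit at the step where \<open>q\<close> is found still counts; the comparison there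
  contributes 0.\<close>

definition tree :: "nat set \<Rightarrow> rat \<Rightarrow> rat" where
  "tree A q = tree_upto A q (Suc (rat_rank q))"

lemma wt_pos [simp]: "0 < wt i" by (simp add: wt_def)

lemma wt_nonzero [simp]: "wt i \<noteq> 0" by (simp add: wt_def)

lemma wt_Suc: "wt (Suc i) = 16 * of_nat (Suc i) * wt i"
  by (simp add: wt_def algebra_simps)

lemma wt_Suc_ge: "16 * wt i \<le> wt (Suc i)"
proof -
  have "16 * wt i * 1 \<le> 16 * wt i * of_nat (Suc i)"
    by (intro mult_left_mono) (auto simp: less_imp_le)
  then show ?thesis by (simp add: wt_Suc algebra_simps)
qed

lemma wt_mono: "i \<le> j \<Longrightarrow> wt i \<le> wt j"
proof (induction rule: dec_induct)
  case (step n)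
  then show ?case using wt_Suc_ge[of n] wt_pos[of n] by linarith
qed simp

lemma digit_abs: "\<bar>digit A q i\<bar> \<le> 5" "digit A q i \<noteq> 0"
  by (auto simp: digit_def sgn_if)

lemma sum_wt_le: "n \<le> m \<Longrightarrow> (\<Sum>i=n..<m. 1 / wt i) \<le> 16 / 15 / wt n - 16 / 15 / wt m"
proof (induction rule: dec_induct)
  case (step m)
  have "16 / wt (Suc m) \<le> 1 / wt m"
    using wt_Suc_ge[of m] wt_pos[of m] wt_pos[of "Suc m"] by (simp add: divide_simps)
  then show ?case using step by simp
qed simp

text \<open>Digits are at most 5 in absolute value and weights grow by a factor of at least 16, so
  the tail stays below 5 * 16/15 = 16/3 units of \<open>1 / wt n\<close>; 6 is a convenient larger
  bound.\<close>

lemma tree_prefix: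
  assumes "n \<le> Suc (rat_rank q)"
  shows "\<bar>tree A q - tree_upto A q n\<bar> < 6 / wt n"
proof -
  define m where "m = Suc (rat_rank q)"
  have nm: "n \<le> m" using assms by (simp add: m_def)
  have "tree A q - tree_upto A q n = (\<Sum>i=n..<m. digit A q i / wt i)"
    using nm sum.atLeastLessThan_concat[of 0 n m "\<lambda>i. digit A q i / wt i"]
    by (simp add: tree_def tree_upto_def lessThan_atLeast0 flip: m_def)
  also have "\<bar>\<dots>\<bar> \<le> (\<Sum>i=n..<m. 5 * (1 / wt i))"
    using digit_abs wt_pos
    by (intro order_trans[OF sum_abs] sum_mono) (simp add: divide_right_mono less_imp_le)
  also have "\<dots> \<le> 5 * (16 / 15 / wt n - 16 / 15 / wt m)"
    using sum_wt_le[OF nm] unfolding sum_distrib_left[symmetric] by simp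
  also have "\<dots> < 6 / wt n"
  proof -
    have "0 < 1 / wt n" "0 < 1 / wt m" by simp_all
    moreover have "5 * (16 / 15 / wt n - 16 / 15 / wt m) = 16 / 3 * (1 / wt n) - 16 / 3 * (1 / wt m)"
      "6 / wt n = 6 * (1 / wt n)" by simp_all
    ultimately show ?thesis by linarith
  qed
  finally show ?thesis .
qed

lemma tree_upto_cong:
  "(\<And>i. i < n \<Longrightarrow> (i \<in> A \<longleftrightarrow> i \<in> B) \<and> sgn (q - rat_enum i) = sgn (r - rat_enum i))
    \<Longrightarrow> tree_upto A q n = tree_upto B r n"
  unfolding tree_upto_def digit_def by (intro sum.cong) auto

lemma sgn_diff_eq:
  fixes q r x :: "'a :: linordered_idom"
  assumes "\<not> (q \<le> x \<and> x \<le> r)" "q < r"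
  shows "sgn (q - x) = sgn (r - x)"
  using assms by (auto simp: sgn_if)

lemma tree_bound: "\<bar>tree A q\<bar> < 6"
  using tree_prefix[of 0 q A] by (simp add: tree_upto_def wt_def)

text \<open>At the first enumerated point between \<open>q\<close> and \<open>r\<close> the digits
  differ by at least 1, and the two tails cost less than 2 * 6/16 of that unit, which leaves 1/4. As
  \<open>q\<close> and \<open>r\<close> are such points themselves, the step is bounded by either
  rank; so the gap at \<open>q\<close> has a bound that does not depend on \<open>r\<close>.\<close>

lemma tree_gap:
  assumes "q < r"
  shows "1 / (4 * wt (min (rat_rank q) (rat_rank r))) \<le> tree A r - tree A q"
proof -
  define n where "n = (LEAST i. q \<le> rat_enum i \<and> rat_enum i \<le> r)"
  have n: "q \<le> rat_enum n" "rat_enum n \<le> r"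
    using LeastI[of "\<lambda>i. q \<le> rat_enum i \<and> rat_enum i \<le> r" "rat_rank q"] assms by (auto simp: n_def)
  have least: "n \<le> i" if "q \<le> rat_enum i" "rat_enum i \<le> r" for i
    unfolding n_def using that by (intro Least_le) auto
  have nq: "n \<le> rat_rank q" "n \<le> rat_rank r" using least assms by auto
  have "tree_upto A q n = tree_upto A r n"
    using least assms by (intro tree_upto_cong conjI refl sgn_diff_eq) (auto simp: not_le[symmetric])
  moreover have "1 \<le> digit A r n - digit A q n"
    using n assms by (auto simp: digit_def sgn_if)
  then have "1 / wt n \<le> digit A r n / wt n - digit A q n / wt n"
    using wt_pos[of n] by (simp add: divide_simps)
  ultimately have "1 / wt n \<le> tree_upto A r (Suc n) - tree_upto A q (Suc n)"
    by (simp add: tree_upto_def)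
  moreover have "6 / wt (Suc n) \<le> 6 / 16 * (1 / wt n)"
    using wt_Suc_ge[of n] wt_pos[of n] wt_pos[of "Suc n"] by (simp add: divide_simps)
  moreover have "\<bar>tree A q - tree_upto A q (Suc n)\<bar> < 6 / wt (Suc n)"
    "\<bar>tree A r - tree_upto A r (Suc n)\<bar> < 6 / wt (Suc n)"
    using nq by (intro tree_prefix; simp)+
  ultimately have "1 / 4 * (1 / wt n) \<le> tree A r - tree A q" by linarith
  moreover have "1 / (4 * wt (min (rat_rank q) (rat_rank r))) \<le> 1 / 4 * (1 / wt n)"
    using nq wt_mono[of n "min (rat_rank q) (rat_rank r)"] wt_pos by (simp add: divide_simps)
  ultimately show ?thesis by linarith
qed

lemma strict_mono_tree: "strict_mono (tree A)"
proof (rule strict_monoI)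
  fix q r :: rat assume "q < r"
  have "0 < 1 / (4 * wt (min (rat_rank q) (rat_rank r)))" using wt_pos by simp
  then show "tree A q < tree A r" using tree_gap[OF \<open>q < r\<close>, of A] by linarith
qed

lemma wt_tree_upto_Ints: "n \<ge> 1 \<Longrightarrow> wt (n - 1) * tree_upto A q n \<in> \<int>"
proof (induction n)
  case (Suc n)
  have "digit A q n \<in> \<int>" by (auto simp: digit_def sgn_if)
  show ?case
  proof (cases n)
    case 0
    then show ?thesis using \<open>digit A q n \<in> \<int>\<close> by (simp add: tree_upto_def wt_def)
  next
    case (Suc m)
    have "wt n * tree_upto A q n = of_nat (16 * n) * (wt (n - 1) * tree_upto A q n)"
      using Suc by (simp add: wt_Suc)
    also have "\<dots> \<in> \<int>" using Suc.IH Suc by (intro Ints_mult[OF Ints_of_nat]) auto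
    finally have "wt n * tree_upto A q n + digit A q n \<in> \<int>" using \<open>digit A q n \<in> \<int>\<close> by simp
    moreover have "wt n * tree_upto A q (Suc n) = wt n * tree_upto A q n + digit A q n"
      by (simp add: tree_upto_def distrib_left)
    ultimately show ?thesis by simp
  qed
qed simp

text \<open>As in the proof that e is irrational: multiplied by \<open>b\<close> and
  \<open>wt (n - 1)\<close>, the difference becomes an integer, and it is smaller than 6/16 in
  absolute value because \<open>wt n\<close> is \<open>16 * n\<close> times
  \<open>wt (n - 1)\<close> and \<open>b \<le> n\<close>.\<close>

lemma tree_upto_eq_rational:
  assumes z: "of_nat b * z \<in> \<int>" and "0 < b" "b \<le> n" and close: "\<bar>z - tree_upto A q n\<bar> < 6 / wt n"
  shows "z = tree_upto A q n"
proof -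
  obtain m where n: "n = Suc m" using assms by (cases n) auto
  define y where "y = of_nat b * wt m * (z - tree_upto A q n)"
  have "wt m \<in> \<int>" by (simp add: wt_def Ints_mult Ints_power fact_in_Ints)
  then have "wt m * (of_nat b * z) - of_nat b * (wt m * tree_upto A q n) \<in> \<int>"
    using z wt_tree_upto_Ints[of n A q] n
    by (intro Ints_diff Ints_mult[OF _ z] Ints_mult[OF Ints_of_nat]) auto
  then have "y \<in> \<int>" by (simp add: y_def algebra_simps)
  have "\<bar>y\<bar> = of_nat b * wt m * \<bar>z - tree_upto A q n\<bar>"
    using wt_pos[of m] by (simp add: y_def abs_mult del: wt_pos)
  also have "\<dots> < of_nat b * wt m * (6 / wt n)"
    using close \<open>0 < b\<close> wt_pos[of m] by (intro mult_strict_left_mono) auto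
  also have "\<dots> = 6 / 16 * (of_nat b / of_nat n)"
    using wt_pos[of m] n by (simp add: wt_Suc del: of_nat_Suc)
  also have "\<dots> \<le> 6 / 16 * 1"
    using \<open>b \<le> n\<close> \<open>0 < b\<close> by (intro mult_left_mono) auto
  finally have "\<bar>y\<bar> < 1" by simp
  then have "y = 0" using \<open>y \<in> \<int>\<close> by (meson Ints_nonzero_abs_less1)
  then show ?thesis using \<open>0 < b\<close> wt_pos[of m] by (simp add: y_def)
qed

text \<open>Let \<open>b\<close> be the denominator of \<open>z\<close>. If none of the points
  \<open>rat_enum 0\<close>, ..., \<open>rat_enum b\<close> lies between \<open>q\<close> and
  \<open>r\<close>, their expansions share the digits up to index \<open>b\<close>. Then
  \<open>z\<close>, squeezed between them, equals the truncations at \<open>b\<close> and at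
  \<open>Suc b\<close>, which differ by a nonzero digit.\<close>

lemma tree_rational_cut:
  obtains F where "finite F"
    "\<And>q r. tree A q < z \<Longrightarrow> z < tree A r \<Longrightarrow> \<exists>x\<in>F. q \<le> x \<and> x \<le> r"
proof -
  obtain a c where ac: "quotient_of z = (a, c)" by fastforce
  define b where "b = nat c"
  have "0 < c" "z = of_int a / of_int c"
    using ac quotient_of_denom_pos quotient_of_div by blast+
  then have b: "0 < b" "of_nat b * z \<in> \<int>" by (auto simp: b_def)
  have "\<exists>x\<in>rat_enum ` {..b}. q \<le> x \<and> x \<le> r" if qr: "tree A q < z" "z < tree A r" for q r
  proof (rule ccontr)
    assume none: "\<not> ?thesis"
    have "tree A q < tree A r" using qr by simp
    then have "q < r" using strict_mono_tree by (simp add: strict_mono_less)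
    have far: "b < rat_rank q" "b < rat_rank r" using none \<open>q < r\<close> by (force simp: not_le[symmetric])+
    have "z = tree_upto A q n" if "b \<le> n" "n \<le> Suc b" for n
    proof (rule tree_upto_eq_rational[OF b(2,1) that(1)])
      have "tree_upto A q n = tree_upto A r n"
        using that none \<open>q < r\<close> by (intro tree_upto_cong conjI refl sgn_diff_eq) auto
      moreover have "\<bar>tree A q - tree_upto A q n\<bar> < 6 / wt n" "\<bar>tree A r - tree_upto A r n\<bar> < 6 / wt n"
        using far that by (intro tree_prefix; simp)+
      ultimately show "\<bar>z - tree_upto A q n\<bar> < 6 / wt n" using qr by linarith
    qed
    from this[of b] this[of "Suc b"] have "digit A q b / wt b = 0" by (simp add: tree_upto_def)
    then show False using digit_abs(2)[of A q b] wt_pos[of b] by simp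
  qed
  then show thesis using that[of "rat_enum ` {..b}"] by blast
qed

section \<open>Extension of maps with bounded, isolated values\<close>

definition isolated_set :: "rat set \<Rightarrow> bool" where
  "isolated_set X \<longleftrightarrow> (\<forall>x\<in>X. \<exists>\<epsilon>>0. \<forall>y\<in>X. y \<noteq> x \<longrightarrow> \<epsilon> \<le> \<bar>y - x\<bar>)"

text \<open>A cut with a last point below or a first point above has room because the value there is
  isolated; a cut with an empty side has room because of \<open>B\<close>. Other cuts do not occur:
  \<open>c\<close> and \<open>d\<close> could be moved towards \<open>z\<close> past all of the
  finite set \<open>X\<close>, and no point of \<open>X\<close> would remain between them.\<close>

lemma strict_mono_extension_isolated:
  fixes t v :: "'i \<Rightarrow> rat"
  assumes less: "\<And>i j. i \<in> I \<Longrightarrow> j \<in> I \<Longrightarrow> t i < t j \<Longrightarrow> v i < v j"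
    and eq: "\<And>i j. i \<in> I \<Longrightarrow> j \<in> I \<Longrightarrow> t i = t j \<Longrightarrow> v i = v j"
    and iso: "isolated_set (v ` I)" and bound: "\<And>i. i \<in> I \<Longrightarrow> \<bar>v i\<bar> \<le> B"
    and cut: "\<And>z. \<exists>X. finite X \<and> (\<forall>c\<in>t ` I. \<forall>d\<in>t ` I. c < z \<longrightarrow> z < d \<longrightarrow> (\<exists>x\<in>X \<inter> t ` I. c \<le> x \<and> x \<le> d))"
  obtains k where "strict_mono k" "\<And>i. i \<in> I \<Longrightarrow> k (t i) = v i"
proof (rule strict_mono_extension[of I t v])
  have le: "v i \<le> v j" if "i \<in> I" "j \<in> I" "t i \<le> t j" for i j
    using less[of i j] eq[of i j] that by (auto simp: le_less)
  have gap: "\<exists>\<epsilon>>0. \<forall>j\<in>I. v j \<noteq> v i \<longrightarrow> \<epsilon> \<le> \<bar>v j - v i\<bar>" if "i \<in> I" for i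
    using iso that unfolding isolated_set_def by auto
  fix z assume z: "z \<notin> t ` I"
  define P where "P u w \<longleftrightarrow> u < w \<and> (\<forall>i\<in>I. t i < z \<longrightarrow> v i \<le> u) \<and> (\<forall>i\<in>I. z < t i \<longrightarrow> w \<le> v i)" for u w
  consider "\<forall>i\<in>I. z < t i" | "\<forall>i\<in>I. t i < z"
    | i where "i \<in> I" "t i < z" "\<forall>j\<in>I. t j < z \<longrightarrow> t j \<le> t i"
    | i where "i \<in> I" "z < t i" "\<forall>j\<in>I. z < t j \<longrightarrow> t i \<le> t j"
    | "\<exists>i\<in>I. t i < z" "\<exists>i\<in>I. z < t i"
      "\<forall>i\<in>I. t i < z \<longrightarrow> (\<exists>j\<in>I. t j < z \<and> t i < t j)"
      "\<forall>i\<in>I. z < t i \<longrightarrow> (\<exists>j\<in>I. z < t j \<and> t j < t i)"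
    using z by (metis image_eqI linorder_cases not_le)
  then have "\<exists>u w. P u w"
  proof cases
    case 1
    then have "P (- B - 1) (- B)" using bound by (force simp: P_def abs_le_iff)
    then show ?thesis by blast
  next
    case 2
    then have "P B (B + 1)" using bound by (force simp: P_def abs_le_iff)
    then show ?thesis by blast
  next
    case (3 i)
    then obtain \<epsilon> where \<epsilon>: "\<epsilon> > 0" "\<forall>j\<in>I. v j \<noteq> v i \<longrightarrow> \<epsilon> \<le> \<bar>v j - v i\<bar>" using gap by blast
    have "v i + \<epsilon> \<le> v j" if "j \<in> I" "z < t j" for j
      using \<epsilon> less[of i j] that 3 by force
    then have "P (v i) (v i + \<epsilon>)" using 3 le \<epsilon> by (auto simp: P_def)
    then show ?thesis by blast
  next
    case (4 i)
    then obtain \<epsilon> where \<epsilon>: "\<epsilon> > 0" "\<forall>j\<in>I. v j \<noteq> v i \<longrightarrow> \<epsilon> \<le> \<bar>v j - v i\<bar>" using gap by blast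
    have "v j \<le> v i - \<epsilon>" if "j \<in> I" "t j < z" for j
      using \<epsilon> less[of j i] that 4 by force
    then have "P (v i - \<epsilon>) (v i)" using 4 le \<epsilon> by (auto simp: P_def)
    then show ?thesis by blast
  next
    case 5
    obtain X where "finite X" and X: "\<And>c d. c \<in> t ` I \<Longrightarrow> d \<in> t ` I \<Longrightarrow> c < z \<Longrightarrow> z < d
        \<Longrightarrow> \<exists>x\<in>X \<inter> t ` I. c \<le> x \<and> x \<le> d"
      using cut by metis
    have "\<exists>c\<in>t ` I. c < z \<and> (\<forall>x\<in>L. x < c)" if "finite L" "L \<subseteq> {x \<in> t ` I. x < z}" for L
      using that
    proof (induction L)
      case (insert x L)
      then obtain c where "c \<in> t ` I" "c < z" "\<forall>x\<in>L. x < c" by auto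
      moreover obtain d where "d \<in> t ` I" "d < z" "x < d" using insert.prems 5(3) by blast
      ultimately show ?case by (intro bexI[of _ "max c d"]) (auto simp: max_def)
    qed (use 5 in auto)
    from this[of "{x \<in> X \<inter> t ` I. x < z}"] \<open>finite X\<close>
    obtain c where c: "c \<in> t ` I" "c < z" "\<forall>x\<in>X \<inter> t ` I. x < z \<longrightarrow> x < c" by auto
    have "\<exists>c\<in>t ` I. z < c \<and> (\<forall>x\<in>L. c < x)" if "finite L" "L \<subseteq> {x \<in> t ` I. z < x}" for L
      using that
    proof (induction L)
      case (insert x L)
      then obtain c where "c \<in> t ` I" "z < c" "\<forall>x\<in>L. c < x" by auto
      moreover obtain d where "d \<in> t ` I" "z < d" "d < x" using insert.prems 5(4) by blast
      ultimately show ?case by (intro bexI[of _ "min c d"]) (auto simp: min_def)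
    qed (use 5 in auto)
    from this[of "{x \<in> X \<inter> t ` I. z < x}"] \<open>finite X\<close>
    obtain d where d: "d \<in> t ` I" "z < d" "\<forall>x\<in>X \<inter> t ` I. z < x \<longrightarrow> d < x" by auto
    obtain x where "x \<in> X \<inter> t ` I" "c \<le> x" "x \<le> d" using X c d by blast
    then show ?thesis using c d z by (metis IntE linorder_cases not_le)
  qed
  then show "\<exists>u w. u < w \<and> (\<forall>i\<in>I. t i < z \<longrightarrow> v i \<le> u) \<and> (\<forall>i\<in>I. z < t i \<longrightarrow> w \<le> v i)"
    unfolding P_def .
qed (blast intro: less eq that)+

text \<open>
  On \<open>F\<close> the maps \<open>f\<close>, \<open>w\<close>, \<open>g\<close> agree, and on each component of the complement of \<open>F\<close> the image of \<open>f\<close> lies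
  below that of \<open>g\<close>, separated by the constant value of \<open>w\<close>. These conditions determine the joint order
  type of the three maps.
\<close>

definition layered :: "rat set \<Rightarrow> (rat \<Rightarrow> rat) \<Rightarrow> (rat \<Rightarrow> rat) \<Rightarrow> (rat \<Rightarrow> rat) \<Rightarrow> bool" where
  "layered F f w g \<longleftrightarrow> strict_mono f \<and> strict_mono g \<and>
     (\<forall>q. if q \<in> F then f q = w q \<and> w q = g q else f q < w q \<and> w q < g q) \<and>
     (\<forall>q r. q < r \<and> \<not> (\<exists>p\<in>F. q \<le> p \<and> p \<le> r) \<longrightarrow> w q = w r)"

text \<open>Three maps become one indexed family, so that a single extension respects their joint
  order.\<close>

definition layer :: "('a \<Rightarrow> 'b) \<Rightarrow> ('a \<Rightarrow> 'b) \<Rightarrow> ('a \<Rightarrow> 'b) \<Rightarrow> nat \<times> 'a \<Rightarrow> 'b" where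
  "layer f w g i = (if fst i = 0 then f else if fst i = 1 then w else g) (snd i)"

lemma layer_simps [simp]:
  "layer f w g (0, q) = f q" "layer f w g (Suc 0, q) = w q" "layer f w g (2, q) = g q"
  by (auto simp: layer_def)

lemma layered_le: "layered F f w g \<Longrightarrow> f q \<le> w q \<and> w q \<le> g q"
  unfolding layered_def by (metis order_refl less_imp_le)

lemma layered_on: "layered F f w g \<Longrightarrow> q \<in> F \<Longrightarrow> w q = f q \<and> g q = f q"
  by (auto simp: layered_def)

lemma layered_off: "layered F f w g \<Longrightarrow> q \<notin> F \<Longrightarrow> f q < w q \<and> w q < g q"
  by (auto simp: layered_def)

lemma layered_const:
  "layered F f w g \<Longrightarrow> \<not> (\<exists>p\<in>F. q \<le> p \<and> p \<le> r) \<Longrightarrow> \<not> (\<exists>p\<in>F. r \<le> p \<and> p \<le> q) \<Longrightarrow> w q = w r"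
  unfolding layered_def by (metis linorder_cases)

text \<open>The chain is \<open>g q \<le> g p = f p \<le> f r\<close>, strict on a side where
  \<open>p\<close> is not the endpoint. So a point of \<open>F\<close> separates all layers at
  \<open>q\<close> from all layers at \<open>r\<close>.\<close>

lemma layered_sep:
  assumes "layered F f w g" "q < r" "p \<in> F" "q \<le> p" "p \<le> r"
  shows "g q < f r"
proof -
  have sm: "strict_mono f" "strict_mono g"
    using assms by (auto simp: layered_def)
  then have "g q \<le> g p" "f p \<le> f r"
    using assms by (simp_all add: strict_mono_less_eq)
  moreover have gp: "g p = f p"
    using assms by (auto simp: layered_def)
  moreover have "g q < g p \<or> f p < f r"
    using assms sm by (auto simp: strict_mono_less)
  ultimately show ?thesis using gp by auto
qed

lemma layered_mono: "layered F f w g \<Longrightarrow> (f q < f r \<longleftrightarrow> q < r) \<and> (g q < g r \<longleftrightarrow> q < r)"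
  by (auto simp: layered_def strict_mono_less)

text \<open>If a point of \<open>F\<close> lies between the two arguments,
  \<open>layered_sep\<close> decides their order in both triples. Otherwise they share a component,
  where \<open>f\<close> is below the constant \<open>w\<close> and \<open>g\<close> above it, and
  within \<open>f\<close> or \<open>g\<close> the order is that of the arguments.\<close>

lemma layered_transfer:
  assumes L: "layered F f w g" and L': "layered F f' w' g'"
    and i: "i \<in> {0, 1, 2} \<times> UNIV" and j: "j \<in> {0, 1, 2} \<times> UNIV"
  shows "layer f w g i < layer f w g j \<Longrightarrow> layer f' w' g' i < layer f' w' g' j"
    and "layer f w g i = layer f w g j \<Longrightarrow> layer f' w' g' i = layer f' w' g' j"
proof -
  obtain a q where iq: "i = (a, q)" by fastforce
  obtain b r where jr: "j = (b, r)" by fastforce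
  have ab: "a = 0 \<or> a = 1 \<or> a = 2" "b = 0 \<or> b = 1 \<or> b = 2" using i j iq jr by auto
  have "(layer f w g i < layer f w g j \<longrightarrow> layer f' w' g' i < layer f' w' g' j) \<and>
    (layer f w g i = layer f w g j \<longrightarrow> layer f' w' g' i = layer f' w' g' j)"
  proof (cases "\<exists>p\<in>F. min q r \<le> p \<and> p \<le> max q r")
    case True
    then obtain p where p: "p \<in> F" "min q r \<le> p" "p \<le> max q r" by blast
    consider "q < r" | "r < q" | "q = r" "q \<in> F" using p by (metis antisym linorder_cases max.idem min.idem)
    then show ?thesis
    proof cases
      case 1
      then have "g' q < f' r" using layered_sep[OF L' _ p(1)] p by simp
      moreover have "g q < f r" using layered_sep[OF L _ p(1)] p 1 by simp
      moreover note layered_le[OF L, of q] layered_le[OF L, of r]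
        layered_le[OF L', of q] layered_le[OF L', of r]
      ultimately show ?thesis using ab iq jr by (elim disjE) auto
    next
      case 2
      then have "g r < f q" using layered_sep[OF L _ p(1)] p by simp
      moreover note layered_le[OF L, of q] layered_le[OF L, of r]
      ultimately show ?thesis using ab iq jr by (elim disjE) auto
    next
      case 3
      then show ?thesis using ab iq jr layered_on[OF L] layered_on[OF L'] by auto
    qed
  next
    case False
    then have "\<not> (\<exists>p\<in>F. q \<le> p \<and> p \<le> r)" "\<not> (\<exists>p\<in>F. r \<le> p \<and> p \<le> q)" and off: "q \<notin> F" "r \<notin> F"
      by (auto simp: min_le_iff_disj le_max_iff_disj)
    then have qr: "q \<notin> F" "r \<notin> F" "w q = w r" "w' q = w' r"
      using layered_const[OF L, of q r] layered_const[OF L', of q r] by blast+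
    show ?thesis
      using ab iq jr qr layered_off[OF L, of q] layered_off[OF L, of r]
        layered_off[OF L', of q] layered_off[OF L', of r]
        layered_mono[OF L, of q r] layered_mono[OF L', of q r]
        layered_mono[OF L, of r q] layered_mono[OF L', of r q]
      by (elim disjE) (auto dest: order_antisym simp: not_less)
  qed
  then show "layer f w g i < layer f w g j \<Longrightarrow> layer f' w' g' i < layer f' w' g' j"
    "layer f w g i = layer f w g j \<Longrightarrow> layer f' w' g' i = layer f' w' g' j" by auto
qed

lemma layer_image: "layer f w g ` ({0, 1, 2} \<times> UNIV) = range f \<union> range w \<union> range g"
  by (auto simp: layer_def image_iff)

text \<open>\<open>h q\<close> records which points of \<open>F\<close> are at most \<open>q\<close>
  and which are less than \<open>q\<close>; this names the component of \<open>q\<close>, or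
  \<open>q\<close> itself if it lies in \<open>F\<close>.\<close>

lemma finite_range_layered:
  assumes "finite F" and L: "layered F f w g"
  shows "finite (range w)"
proof -
  define h where "h q = (F \<inter> {..q}, F \<inter> {..<q})" for q
  have w: "w q = w r" if "h q = h r" for q r
  proof (cases "q = r")
    case False
    then have "\<not> (\<exists>p\<in>F. q \<le> p \<and> p \<le> r) \<and> \<not> (\<exists>p\<in>F. r \<le> p \<and> p \<le> q)"
      using that unfolding h_def by (auto simp: set_eq_iff) (metis le_less not_le)+
    then show ?thesis using layered_const[OF L] by blast
  qed simp
  have "range w \<subseteq> (\<lambda>s. w (inv h s)) ` (Pow F \<times> Pow F)"
  proof safe
    fix q
    have "h (inv h (h q)) = h q" by (simp add: f_inv_into_f)
    then have "w q = w (inv h (h q))" using w by metis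
    moreover have "h q \<in> Pow F \<times> Pow F" by (auto simp: h_def)
    ultimately show "w q \<in> (\<lambda>s. w (inv h s)) ` (Pow F \<times> Pow F)" by (metis image_eqI)
  qed
  then show ?thesis using \<open>finite F\<close> finite_subset by blast
qed

text \<open>The middle layer is the common truncation before bit \<open>i\<close>. Paths to points
  of \<open>F\<close> end before this bit is read. Off \<open>F\<close> the bit moves
  \<open>tree A\<close> down and \<open>tree B\<close> up by at least 3 units of
  \<open>1 / wt i\<close>, and the tails cannot undo this, being below 6/16 of a unit.\<close>

lemma layered_tree:
  assumes i: "i \<notin> A" "i \<in> B" and agree: "\<And>j. j < i \<Longrightarrow> j \<in> A \<longleftrightarrow> j \<in> B"
    and F: "F = rat_enum ` {..<i}"
  shows "layered F (tree A) (\<lambda>q. if q \<in> F then tree A q else tree_upto A q i) (tree B)"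
proof -
  have F_iff: "q \<in> F \<longleftrightarrow> rat_rank q < i" for q
    unfolding F by (metis imageE imageI lessThan_iff rat_rank_enum enum_rat_rank)
  have on: "tree A q = tree B q" if "q \<in> F" for q
    using that agree unfolding tree_def by (intro tree_upto_cong) (auto simp: F_iff)
  have off: "tree A q < tree_upto A q i \<and> tree_upto A q i < tree B q" if "q \<notin> F" for q
  proof -
    have q: "Suc i \<le> Suc (rat_rank q)" using that by (simp add: F_iff)
    have "tree_upto A q (Suc i) \<le> tree_upto A q i - 3 * (1 / wt i)"
      using i by (auto simp: tree_upto_def digit_def sgn_if divide_simps)
    moreover have "tree_upto B q (Suc i) \<ge> tree_upto B q i + 3 * (1 / wt i)"
      using i by (auto simp: tree_upto_def digit_def sgn_if divide_simps)
    moreover have "tree_upto B q i = tree_upto A q i"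
      using agree by (intro tree_upto_cong) auto
    moreover have "6 / wt (Suc i) \<le> 6 / 16 * (1 / wt i)"
      using wt_Suc_ge[of i] by (simp add: divide_simps)
    moreover have "0 < 1 / wt i" by simp
    ultimately show ?thesis using tree_prefix[OF q, of A] tree_prefix[OF q, of B] by linarith
  qed
  show ?thesis
    unfolding layered_def
  proof (intro conjI allI impI)
    fix q r assume *: "q < r \<and> \<not> (\<exists>p\<in>F. q \<le> p \<and> p \<le> r)"
    then have "q \<notin> F" "r \<notin> F" by auto
    moreover have "tree_upto A q i = tree_upto A r i"
      using * F by (intro tree_upto_cong conjI refl sgn_diff_eq) auto
    ultimately show "(if q \<in> F then tree A q else tree_upto A q i) = (if r \<in> F then tree A r else tree_upto A r i)"
      by simp
  qed (use on off in \<open>auto simp: strict_mono_tree\<close>)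
qed

text \<open>The joint order types agree by \<open>layered_transfer\<close>, so only the cuts have to
  be examined. For \<open>c\<close> and \<open>d\<close> in the same tree, finitely many of its
  points decide; for different layers, a point of \<open>F\<close> or one of the finitely many
  values of the middle layer lies between.\<close>

lemma layered_image_of_trees:
  assumes i: "i \<notin> A" "i \<in> B" and agree: "\<And>j. j < i \<Longrightarrow> j \<in> A \<longleftrightarrow> j \<in> B"
    and L: "layered (rat_enum ` {..<i}) f w g"
    and iso: "isolated_set (range f \<union> range w \<union> range g)"
    and bound: "\<And>x. x \<in> range f \<union> range w \<union> range g \<Longrightarrow> \<bar>x\<bar> \<le> b"
  obtains k where "strict_mono k" "k \<circ> tree A = f" "k \<circ> tree B = g"
proof -
  define F where "F = rat_enum ` {..<i}"
  define m where "m q = (if q \<in> F then tree A q else tree_upto A q i)" for q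
  have T: "layered F (tree A) m (tree B)"
    using layered_tree[OF i agree F_def] unfolding m_def[abs_def] by blast
  have TL: "layered F f w g" using L by (simp add: F_def)
  define I :: "(nat \<times> rat) set" where "I = {0, 1, 2} \<times> UNIV"
  let ?t = "layer (tree A) m (tree B)" and ?v = "layer f w g"
  have tI: "?t ` I = range (tree A) \<union> range m \<union> range (tree B)"
    unfolding I_def by (rule layer_image)
  have vI: "?v ` I = range f \<union> range w \<union> range g"
    unfolding I_def by (rule layer_image)
  obtain k where "strict_mono k" and k: "\<And>i. i \<in> I \<Longrightarrow> k (?t i) = ?v i"
  proof (rule strict_mono_extension_isolated[of I ?t ?v b])
    show "isolated_set (?v ` I)" using iso by (simp add: vI)
    show "\<bar>?v j\<bar> \<le> b" if "j \<in> I" for j using bound vI that by blast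
    fix z
    obtain FA where FA: "finite FA" "\<And>q r. tree A q < z \<Longrightarrow> z < tree A r \<Longrightarrow> \<exists>x\<in>FA. q \<le> x \<and> x \<le> r"
      using tree_rational_cut by blast
    obtain FB where FB: "finite FB" "\<And>q r. tree B q < z \<Longrightarrow> z < tree B r \<Longrightarrow> \<exists>x\<in>FB. q \<le> x \<and> x \<le> r"
      using tree_rational_cut by blast
    define X where "X = tree A ` (FA \<union> F) \<union> tree B ` FB \<union> range m"
    have "finite F" by (simp add: F_def)
    then have "finite X" using FA FB finite_range_layered[OF _ T] by (simp add: X_def)
    have mono: "tree C q \<le> tree C r \<longleftrightarrow> q \<le> r" for C q r
      using strict_mono_tree by (simp add: strict_mono_less_eq)
    have "\<exists>x\<in>X. c \<le> x \<and> x \<le> d" if cd: "c \<in> ?t ` I" "d \<in> ?t ` I" and z: "c < z" "z < d" for c d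
    proof -
      consider "c \<in> range m \<or> d \<in> range m" | q r where "c = tree A q" "d = tree A r"
        | q r where "c = tree B q" "d = tree B r" | q r where "c = tree A q" "d = tree B r"
        | q r where "c = tree B q" "d = tree A r" using cd unfolding tI by blast
      then show ?thesis
      proof cases
        case 1
        then show ?thesis using z unfolding X_def by (meson UnCI less_imp_le less_trans order_refl)
      next
        case (2 q r)
        then show ?thesis using FA(2)[of q r] z mono unfolding X_def by blast
      next
        case (3 q r)
        then show ?thesis using FB(2)[of q r] z mono unfolding X_def by blast
      next
        case (4 q r)
        consider p where "p \<in> F" "q \<le> p" "p \<le> r" | p where "p \<in> F" "r \<le> p" "p \<le> q" | "m q = m r"
          using layered_const[OF T, of q r] by blast
        then show ?thesis
        proof cases
          case (1 p)
          then have "tree A q \<le> tree A p" "tree A p \<le> tree B r"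
            using mono layered_on[OF T, of p] by metis+
          then show ?thesis using 4 1 unfolding X_def by blast
        next
          case (2 p)
          then have "tree B r \<le> tree A q"
            using mono layered_on[OF T, of p] by (metis order_trans)
          then show ?thesis using 4 z by simp
        next
          case 3
          then have "tree A q \<le> m q" "m q \<le> tree B r" using layered_le[OF T] by metis+
          then show ?thesis using 4 unfolding X_def by blast
        qed
      next
        \<comment> \<open>A value of the upper tree below a value of the lower one: this occurs only
          across a point of \<open>F\<close>.\<close>
        case (5 q r)
        have "\<not> r \<le> q"
          using 5 z mono layered_le[OF T, of q] by (meson le_less_trans less_trans not_less order_trans)
        moreover have "m q \<noteq> m r"
          using 5 z layered_le[OF T, of q] layered_le[OF T, of r] by linarith
        ultimately obtain p where p: "p \<in> F" "q \<le> p" "p \<le> r"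
          using layered_const[OF T, of q r] by (meson order_trans)
        then have "tree B q \<le> tree A p" "tree A p \<le> tree A r"
          using mono layered_on[OF T, of p] by metis+
        then show ?thesis using 5 p unfolding X_def by blast
      qed
    qed
    moreover have "X \<subseteq> ?t ` I" unfolding tI X_def by blast
    ultimately show "\<exists>X. finite X \<and> (\<forall>c\<in>?t ` I. \<forall>d\<in>?t ` I. c < z \<longrightarrow> z < d \<longrightarrow> (\<exists>x\<in>X \<inter> ?t ` I. c \<le> x \<and> x \<le> d))"
      using \<open>finite X\<close> by (meson IntI subsetD)
  qed (blast intro: layered_transfer[OF T TL, folded I_def])+
  moreover have "k \<circ> tree A = f" using k[of "(0, _)"] by (auto simp: I_def)
  moreover have "k \<circ> tree B = g" using k[of "(2, _)"] by (auto simp: I_def)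
  ultimately show thesis using that by blast
qed


section \<open>Tame maps\<close>

definition tame :: "(rat \<Rightarrow> rat) \<Rightarrow> bool" where
  "tame f \<longleftrightarrow> strict_mono f \<and> isolated_set (range f) \<and> (\<exists>b. \<forall>x. \<bar>f x\<bar> \<le> b)"

lemma isolated_point:
  fixes f :: "rat \<Rightarrow> rat"
  assumes "isolated_set (range f)" "strict_mono f"
  shows "\<exists>\<epsilon>>0. \<forall>y. y \<noteq> x \<longrightarrow> \<epsilon> \<le> \<bar>f y - f x\<bar>"
proof -
  have "f y = f z \<longleftrightarrow> y = z" for y z using strict_mono_eq[OF assms(2)] by simp
  then show ?thesis using assms(1) unfolding isolated_set_def by simp
qed

lemma tame_tree: "tame (tree A)"
proof -
  have "\<exists>\<epsilon>>0. \<forall>y. tree A y \<noteq> tree A x \<longrightarrow> \<epsilon> \<le> \<bar>tree A y - tree A x\<bar>" for x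
  proof (intro exI[of _ "1 / (4 * wt (rat_rank x))"] conjI allI impI)
    fix y assume "tree A y \<noteq> tree A x"
    then have "x \<noteq> y" by auto
    have "1 / (4 * wt (rat_rank x)) \<le> 1 / (4 * wt (min (rat_rank x) (rat_rank y)))"
      using wt_mono[of "min (rat_rank x) (rat_rank y)" "rat_rank x"] wt_pos
      by (simp add: divide_simps)
    then show "1 / (4 * wt (rat_rank x)) \<le> \<bar>tree A y - tree A x\<bar>"
      using tree_gap[of x y A] tree_gap[of y x A] \<open>x \<noteq> y\<close>
      by (cases "x < y") (auto simp: min.commute)
  qed simp
  then show ?thesis
    using strict_mono_tree tree_bound less_imp_le unfolding tame_def isolated_set_def by blast
qed

text \<open>No continuity of \<open>k\<close> is involved: by monotonicity the images of
  \<open>x - \<epsilon>\<close> and \<open>x + \<epsilon>\<close> keep all other values away from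
  \<open>k x\<close>.\<close>

lemma strict_mono_comp_isolated:
  fixes k :: "rat \<Rightarrow> rat"
  assumes "strict_mono k" "isolated_set X"
  shows "isolated_set (k ` X)"
  unfolding isolated_set_def
proof
  fix y assume "y \<in> k ` X"
  then obtain x where x: "x \<in> X" "y = k x" by blast
  obtain \<epsilon> where \<epsilon>: "\<epsilon> > 0" "\<forall>y\<in>X. y \<noteq> x \<longrightarrow> \<epsilon> \<le> \<bar>y - x\<bar>"
    using assms x by (auto simp: isolated_set_def)
  define \<delta> where "\<delta> = min (k x - k (x - \<epsilon>)) (k (x + \<epsilon>) - k x)"
  have "0 < \<delta>" using \<epsilon> assms by (simp add: \<delta>_def strict_mono_less)
  moreover have "\<delta> \<le> \<bar>k z - k x\<bar>" if "z \<in> X" "k z \<noteq> k x" for z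
  proof -
    have "\<epsilon> \<le> \<bar>z - x\<bar>" using that \<epsilon> by auto
    then have "z \<le> x - \<epsilon> \<or> x + \<epsilon> \<le> z" by linarith
    then have "k z \<le> k (x - \<epsilon>) \<or> k (x + \<epsilon>) \<le> k z" using assms by (simp add: strict_mono_less_eq)
    then show ?thesis unfolding \<delta>_def by linarith
  qed
  ultimately show "\<exists>\<epsilon>>0. \<forall>z\<in>k ` X. z \<noteq> y \<longrightarrow> \<epsilon> \<le> \<bar>z - y\<bar>" using x by blast
qed

lemma tame_comp_left:
  assumes "strict_mono k" "tame f"
  shows "tame (k \<circ> f)"
proof -
  obtain b where b: "\<And>x. \<bar>f x\<bar> \<le> b" using assms by (auto simp: tame_def)
  have "\<bar>k (f x)\<bar> \<le> max \<bar>k b\<bar> \<bar>k (- b)\<bar>" for x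
  proof -
    have "k (- b) \<le> k (f x)" "k (f x) \<le> k b"
      using b[of x] assms by (auto simp: strict_mono_less_eq abs_le_iff)
    then show ?thesis by linarith
  qed
  then show ?thesis
    using assms strict_mono_comp_isolated[of k "range f"]
    unfolding tame_def by (auto simp: strict_mono_o image_comp)
qed

lemma tame_comp_right:
  assumes "tame f" "strict_mono k"
  shows "tame (f \<circ> k)"
proof -
  have "isolated_set (range (f \<circ> k))"
    using assms unfolding tame_def isolated_set_def by auto metis
  then show ?thesis using assms unfolding tame_def by (auto simp: strict_mono_o)
qed

text \<open>This supplies the third map to which \<open>f1\<close> and \<open>f2\<close> are both
  compared. In a component of the complement of \<open>F\<close>, measured downwards from
  \<open>base\<close> in units of \<open>rad\<close>, the values of \<open>f1\<close> and
  \<open>f2\<close> are at distance at least 1, \<open>w\<close> at 2/3, and \<open>g\<close>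
  between 5/8 and 3/8.\<close>

lemma common_upper_layer:
  assumes "finite F" "tame f1" "tame f2" and agree: "\<And>p. p \<in> F \<Longrightarrow> f1 p = f2 p"
  obtains w g b where "\<And>f. f \<in> {f1, f2} \<Longrightarrow> layered F f w g"
    "\<And>f. f \<in> {f1, f2} \<Longrightarrow> isolated_set (range f \<union> range w \<union> range g)"
    "\<And>f x. f \<in> {f1, f2} \<Longrightarrow> x \<in> range f \<union> range w \<union> range g \<Longrightarrow> \<bar>x\<bar> \<le> b"
proof -
  have sm: "f x < f y \<longleftrightarrow> x < y" "f x \<le> f y \<longleftrightarrow> x \<le> y" if "f \<in> {f1, f2}" for f x y
    using that assms by (auto simp: tame_def strict_mono_less strict_mono_less_eq)
  obtain b1 b2 where "\<And>x. \<bar>f1 x\<bar> \<le> b1" "\<And>x. \<bar>f2 x\<bar> \<le> b2"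
    using assms by (auto simp: tame_def)
  then have bd: "\<bar>f x\<bar> \<le> max b1 b2" if "f \<in> {f1, f2}" for f x using that by (auto simp: le_max_iff_disj)
  define B where "B = max b1 b2"
  have iso: "\<exists>\<epsilon>>0. \<forall>y. y \<noteq> x \<longrightarrow> \<epsilon> \<le> \<bar>f y - f x\<bar>" if "f \<in> {f1, f2}" for f x
    using that isolated_point assms by (auto simp: tame_def)
  have "\<exists>\<epsilon>>0. \<forall>f\<in>{f1, f2}. \<forall>y. y \<noteq> p \<longrightarrow> \<epsilon> \<le> \<bar>f y - f p\<bar>" for p
  proof -
    obtain \<epsilon>1 \<epsilon>2 where "\<epsilon>1 > 0" "\<forall>y. y \<noteq> p \<longrightarrow> \<epsilon>1 \<le> \<bar>f1 y - f1 p\<bar>"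
      "\<epsilon>2 > 0" "\<forall>y. y \<noteq> p \<longrightarrow> \<epsilon>2 \<le> \<bar>f2 y - f2 p\<bar>" using iso[of f1 p] iso[of f2 p] by auto
    then show ?thesis by (intro exI[of _ "min \<epsilon>1 \<epsilon>2"]) (auto simp: min_le_iff_disj)
  qed
  then obtain e where e0: "\<And>p. e p > 0"
    and e: "\<And>p f y. f \<in> {f1, f2} \<Longrightarrow> y \<noteq> p \<Longrightarrow> e p \<le> \<bar>f y - f p\<bar>" by metis
  define above where "above q = {p \<in> F. q < p}" for q
  \<comment> \<open>All values at the component of \<open>q\<close> stay below \<open>base q\<close>, and those of \<open>f1\<close>, \<open>f2\<close> even below
    \<open>base q - rad q\<close>, so \<open>w\<close> and \<open>g\<close> fit in between.\<close>
  define base where "base q = (if above q = {} then B + 3 else f1 (Min (above q)))" for q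
  \<comment> \<open>Beyond the last point of \<open>F\<close> the common bound takes over:
    \<open>B + 3\<close> minus the radius 3 is \<open>B\<close>.\<close>
  define rad where "rad q = (if above q = {} then 3 else e (Min (above q)))" for q
  \<comment> \<open>An embedding into (-1, 1) with isolated values; it makes \<open>g\<close>
    strictly monotone within a component and keeps it within \<open>rad q / 8\<close> of its
    center.\<close>
  define \<tau> where "\<tau> q = tree {} q / 6" for q
  define w where "w q = (if q \<in> F then f1 q else base q - rad q * (2 / 3))" for q
  define g where "g q = (if q \<in> F then f1 q else base q - rad q * (1 / 2) + rad q / 8 * \<tau> q)" for q
  have fin: "finite (above q)" for q using \<open>finite F\<close> by (simp add: above_def)
  have rad: "rad q > 0" for q by (simp add: rad_def e0)
  have \<tau>: "\<bar>\<tau> q\<bar> < 1" for q using tree_bound[of "{}" q] by (simp add: \<tau>_def)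
  have rad\<tau>: "\<bar>rad q / 8 * \<tau> q\<bar> \<le> rad q / 8" for q
    using mult_left_mono[of "\<bar>\<tau> q\<bar>" 1 "rad q / 8"] \<tau>[of q] rad[of q] by (simp add: abs_mult)
  have base_ge: "f q \<le> base q - rad q" if "f \<in> {f1, f2}" for f q
  proof (cases "above q = {}")
    case True
    then show ?thesis using bd[OF that, of q] by (auto simp: base_def rad_def B_def)
  next
    case False
    define p where "p = Min (above q)"
    have "p \<in> above q" unfolding p_def using fin False by (rule Min_in)
    then have "p \<in> F" "q < p" by (auto simp: above_def)
    then have "f q < f p" "f p = f1 p" "e p \<le> \<bar>f q - f p\<bar>"
      using sm that agree e[OF that, of q p] by auto
    then show ?thesis using False by (simp add: base_def rad_def flip: p_def)
  qed
  have base_le: "base q \<le> f r" if "f \<in> {f1, f2}" "q \<notin> F" "p \<in> F" "q \<le> p" "p \<le> r" for f q p r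
  proof -
    have p: "p \<in> above q" using that by (auto simp: above_def le_less)
    define m where "m = Min (above q)"
    have m: "m \<in> above q" "m \<le> r" using Min_in[OF fin, of q] Min_le[OF fin p] p that by (auto simp: m_def)
    moreover have "above q \<noteq> {}" using p by blast
    moreover have "f1 m = f m" using m agree that by (auto simp: above_def)
    ultimately have "base q = f m" by (simp add: base_def flip: m_def)
    then show ?thesis using sm that m by auto
  qed
  have const: "base q = base r \<and> rad q = rad r" if "q < r" "\<not> (\<exists>p\<in>F. q \<le> p \<and> p \<le> r)" for q r
  proof -
    have "above q = above r" using that unfolding above_def
      by (metis (no_types, lifting) less_imp_le less_trans not_less)
    then show ?thesis by (simp add: base_def rad_def)
  qed
  have on: "w q = f q" "g q = f q" if "q \<in> F" "f \<in> {f1, f2}" for f q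
    using that agree by (auto simp: w_def g_def)
  have w: "w q = base q - rad q * (2 / 3)" if "q \<notin> F" for q using that by (simp add: w_def)
  have g: "base q - rad q * (5 / 8) \<le> g q" "g q \<le> base q - rad q * (3 / 8)" if "q \<notin> F" for q
    using that rad\<tau>[of q] by (auto simp: g_def abs_le_iff)
  have fwg: "f q < w q \<and> w q < g q" if "q \<notin> F" "f \<in> {f1, f2}" for f q
    using w g base_ge[OF that(2), of q] rad[of q] that by (force simp: algebra_simps)
  have le: "f q \<le> w q \<and> w q \<le> g q" if "f \<in> {f1, f2}" for f q
    using fwg[OF _ that, of q] on[OF _ that, of q] by (cases "q \<in> F") auto
  have gsep: "g q < f r" if "f \<in> {f1, f2}" "q < r" "p \<in> F" "q \<le> p" "p \<le> r" for f q p r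
  proof (cases "q \<in> F")
    case True
    then show ?thesis using on(2)[OF True that(1)] sm that by simp
  next
    case False
    then show ?thesis using g[OF False] base_le[OF that(1) False] that rad[of q] by force
  qed
  have L: "layered F f w g" if f: "f \<in> {f1, f2}" for f
    unfolding layered_def
  proof (intro conjI allI impI)
    show "strict_mono f" using f assms by (auto simp: tame_def)
    show "strict_mono g"
    proof (rule strict_monoI)
      fix q r :: rat assume qr: "q < r"
      show "g q < g r"
      proof (cases "\<exists>p\<in>F. q \<le> p \<and> p \<le> r")
        case True
        then show ?thesis using gsep[OF f qr] le[OF f, of r] by force
      next
        case False
        then have "q \<notin> F" "r \<notin> F" using qr by auto
        moreover have "\<tau> q < \<tau> r" using qr strict_mono_tree by (simp add: \<tau>_def strict_mono_less)
        ultimately show ?thesis using const[OF qr False] rad[of r] by (simp add: g_def)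
      qed
    qed
    show "if q \<in> F then f q = w q \<and> w q = g q else f q < w q \<and> w q < g q" for q
      using on[OF _ f] fwg[OF _ f] by auto
    show "w q = w r" if "q < r \<and> \<not> (\<exists>p\<in>F. q \<le> p \<and> p \<le> r)" for q r
      using that const[of q r] by (auto simp: w_def)
  qed
  have bound: "\<bar>x\<bar> \<le> B + 3" if "f \<in> {f1, f2}" and x: "x \<in> range f \<union> range w \<union> range g" for f x
  proof -
    obtain q where q: "x \<in> {f q, w q, g q}" using x by blast
    have "base q \<le> B + 3" using bd[of f1 "Min (above q)"] by (auto simp: base_def B_def)
    then have "g q \<le> B + 3"
      using g[of q] rad[of q] on(2)[OF _ that(1), of q] bd[OF that(1), of q] by (cases "q \<in> F") (auto simp: B_def)
    moreover have "- (B + 3) \<le> f q" using bd[OF that(1), of q] by (auto simp: B_def)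
    ultimately show ?thesis using le[OF that(1), of q] q by (auto simp: abs_le_iff)
  qed
  have isolated: "isolated_set (range f \<union> range w \<union> range g)" if f: "f \<in> {f1, f2}" for f
    unfolding isolated_set_def
  proof
    fix x assume "x \<in> range f \<union> range w \<union> range g"
    then obtain q where q: "x \<in> {f q, w q, g q}" by auto
    show "\<exists>\<epsilon>>0. \<forall>y\<in>range f \<union> range w \<union> range g. y \<noteq> x \<longrightarrow> \<epsilon> \<le> \<bar>y - x\<bar>"
    proof (cases "q \<in> F")
      case True
      then have x: "x = f q" using q on[OF True f] by auto
      \<comment> \<open>The critical values are those of \<open>g\<close> in the component just
        below \<open>q\<close>: its base is \<open>f q\<close> and its radius \<open>e q\<close>,
        and \<open>g\<close> stays 3/8 of the radius below the base.\<close>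
      have "e q * (3 / 8) \<le> \<bar>y - x\<bar>" if y: "y \<in> {f r, w r, g r}" "y \<noteq> x" for y r
      proof -
        consider "q < r" | "r < q" "r \<in> F" | p where "r < p" "p < q" "p \<in> F"
          | "r < q" "r \<notin> F" "\<not> (\<exists>p\<in>F. r < p \<and> p < q)" | "r = q" by (metis linorder_cases)
        then show ?thesis
        proof cases
          case 1
          then have "e q \<le> f r - f q" using e[OF f, of r q] sm[OF f] by fastforce
          then show ?thesis using y le[OF f, of r] x e0[of q] by auto
        next
          case 2
          then have "e q \<le> f q - f r" using e[OF f, of r q] sm[OF f] by fastforce
          then show ?thesis using y on[OF 2(2) f] x e0[of q] by auto
        next
          case (3 p)
          then have "e q \<le> f q - f p" using e[OF f, of p q] sm[OF f] by fastforce
          moreover have "g r < f p" using gsep[OF f 3(1) 3(3)] 3 by simp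
          ultimately show ?thesis using y le[OF f, of r] x e0[of q] by auto
        next
          case 4
          have "Min (above r) = q"
            using 4 True fin by (intro Min_eqI) (auto simp: above_def not_less)
          moreover have "above r \<noteq> {}" using 4 True by (auto simp: above_def)
          ultimately have "base r = f q" "rad r = e q" using agree True f by (auto simp: base_def rad_def)
          then have "g r \<le> f q - e q * (3 / 8)" using g(2)[OF 4(2)] by simp
          then show ?thesis using y le[OF f, of r] x e0[of q] by auto
        next
          case 5
          then show ?thesis using y x on[OF True f] by auto
        qed
      qed
      then show ?thesis using e0[of q] by (intro exI[of _ "e q * (3 / 8)"]) auto
    next
      case False
      obtain \<gamma> where \<gamma>: "\<gamma> > 0" "\<And>y. y \<noteq> q \<Longrightarrow> \<gamma> \<le> \<bar>\<tau> y - \<tau> q\<bar>"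
      proof -
        obtain \<epsilon> where "\<epsilon> > 0" "\<And>y. y \<noteq> q \<Longrightarrow> \<epsilon> \<le> \<bar>tree {} y - tree {} q\<bar>"
          using tame_tree[of "{}"] isolated_point[of "tree {}" q] unfolding tame_def by blast
        moreover have "\<bar>\<tau> y - \<tau> q\<bar> = \<bar>tree {} y - tree {} q\<bar> / 6" for y
          by (simp add: \<tau>_def flip: diff_divide_distrib)
        ultimately show thesis by (intro that[of "\<epsilon> / 6"]) (auto intro!: divide_right_mono)
      qed
      \<comment> \<open>\<open>e q\<close> isolates \<open>f q\<close> and handles components below,
        1/24 = 2/3 - 5/8 is the narrowest gap between layers, and the last term isolates
        \<open>g q\<close> inside its own component.\<close>
      define \<epsilon> where "\<epsilon> = min (e q) (min (rad q / 24) (rad q / 8 * \<gamma>))"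
      have \<epsilon>: "\<epsilon> > 0" "\<epsilon> \<le> e q" "\<epsilon> \<le> rad q / 24" "\<epsilon> \<le> rad q / 8 * \<gamma>"
        using e0[of q] rad[of q] \<gamma>(1) by (auto simp: \<epsilon>_def)
      have "\<epsilon> \<le> \<bar>y - x\<bar>" if y: "y \<in> {f r, w r, g r}" "y \<noteq> x" for y r
      proof -
        consider p where "q < r" "p \<in> F" "q \<le> p" "p \<le> r" | p where "p < q" "p \<in> F" "r \<le> p"
          | "r \<notin> F" "base r = base q" "rad r = rad q"
          using const[of q r] const[of r q] False by (metis le_less linorder_cases order_refl)
        then show ?thesis
        proof cases
          case (1 p)
          then have "base q \<le> f r" using base_le[OF f False] by blast
          then show ?thesis using y q le[OF f, of r] le[OF f, of q] g[OF False] \<epsilon> rad[of q] by auto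
        next
          case (2 p)
          then have "e q \<le> f q - f p" using e[OF f, of p q] sm[OF f] by fastforce
          moreover have "g r \<le> f p"
            using gsep[OF f _ 2(2,3)] on(2)[OF 2(2) f] 2 by (metis le_less order_refl)
          ultimately show ?thesis using y q le[OF f, of r] le[OF f, of q] \<epsilon> by auto
        next
          case 3
          have "f r \<le> base q - rad q" "f q \<le> base q - rad q" using base_ge[OF f] 3 by metis+
          moreover have "w r = base q - rad q * (2 / 3)" "w q = base q - rad q * (2 / 3)"
            using w 3 False by auto
          moreover have "base q - rad q * (5 / 8) \<le> g r" "base q - rad q * (5 / 8) \<le> g q"
            using g(1) 3 False by metis+
          moreover have "\<epsilon> \<le> \<bar>f r - f q\<bar>" if "r \<noteq> q" using e[OF f that] \<epsilon> by simp
          moreover have "\<epsilon> \<le> \<bar>g r - g q\<bar>" if "r \<noteq> q"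
          proof -
            have "g r - g q = rad q / 8 * (\<tau> r - \<tau> q)"
              using 3 False by (simp add: g_def algebra_simps)
            then have "\<bar>g r - g q\<bar> = \<bar>rad q / 8\<bar> * \<bar>\<tau> r - \<tau> q\<bar>"
              by (simp only: abs_mult)
            moreover have "\<bar>rad q / 8\<bar> = rad q / 8" using rad[of q] by simp
            moreover have "rad q / 8 * \<gamma> \<le> rad q / 8 * \<bar>\<tau> r - \<tau> q\<bar>"
              using \<gamma>(2)[OF that] rad[of q] by (intro mult_left_mono) auto
            ultimately show ?thesis using \<epsilon> by (metis order_trans)
          qed
          ultimately show ?thesis using y q \<epsilon> rad[of q] by auto
        qed
      qed
      then show ?thesis using \<epsilon> by (intro exI[of _ \<epsilon>]) auto
    qed
  qed
  show thesis
    by (rule that[of w g "B + 3"]) (assumption | rule L isolated bound)+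
qed

section \<open>Continuity for strictly monotone maps\<close>

text \<open>What a clone isomorphism induces on unary operations; \<open>act_closed\<close> says
  that pointwise limits of actions are actions. \<open>Es\<close> may be larger than the set of
  strictly monotone maps, so the results on these serve both monoids.\<close>

locale rat_action =
  fixes Es :: "(rat \<Rightarrow> rat) set" and \<Omega> :: "'b set" and act :: "(rat \<Rightarrow> rat) \<Rightarrow> 'b \<Rightarrow> 'b"
  assumes strict_in: "strict_mono f \<Longrightarrow> f \<in> Es"
    and comp_in: "f \<in> Es \<Longrightarrow> g \<in> Es \<Longrightarrow> f \<circ> g \<in> Es"
    and countable_points: "countable \<Omega>"
    and act_in: "f \<in> Es \<Longrightarrow> b \<in> \<Omega> \<Longrightarrow> act f b \<in> \<Omega>"
    and act_comp: "f \<in> Es \<Longrightarrow> g \<in> Es \<Longrightarrow> b \<in> \<Omega> \<Longrightarrow> act (f \<circ> g) b = act f (act g b)"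
    and act_faithful: "f \<in> Es \<Longrightarrow> g \<in> Es \<Longrightarrow> (\<And>b. b \<in> \<Omega> \<Longrightarrow> act f b = act g b) \<Longrightarrow> f = g"
    and act_closed: "\<And>t. (\<And>B. finite B \<Longrightarrow> B \<subseteq> \<Omega> \<Longrightarrow> \<exists>f\<in>Es. \<forall>b\<in>B. act f b = t b) \<Longrightarrow>
      \<exists>f\<in>Es. \<forall>b\<in>\<Omega>. act f b = t b"
begin

lemma tame_support:
  assumes "b \<in> \<Omega>"
  obtains F where "finite F"
    "\<And>f g. tame f \<Longrightarrow> tame g \<Longrightarrow> (\<And>p. p \<in> F \<Longrightarrow> f p = g p) \<Longrightarrow> act f b = act g b"
proof -
  have "\<not> inj (\<lambda>A. act (tree A) b)"
  proof
    assume inj: "inj (\<lambda>A. act (tree A) b)"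
    have "range (\<lambda>A. act (tree A) b) \<subseteq> \<Omega>"
      using act_in strict_in strict_mono_tree assms by blast
    then have "countable (UNIV :: nat set set)"
      using countable_points countable_subset countable_image_inj_on[OF _ inj] by blast
    then have "range (from_nat_into UNIV) = Pow (UNIV :: nat set)" by (simp add: range_from_nat_into)
    then show False using Cantors_theorem by blast
  qed
  then obtain A B where "A \<noteq> B" and eq: "act (tree A) b = act (tree B) b" by (auto simp: inj_def)
  define i where "i = (LEAST i. i \<in> A \<longleftrightarrow> i \<notin> B)"
  have "\<exists>i. i \<in> A \<longleftrightarrow> i \<notin> B" using \<open>A \<noteq> B\<close> by blast
  then have i: "i \<in> A \<longleftrightarrow> i \<notin> B" unfolding i_def by (rule LeastI_ex)
  have agree: "j \<in> A \<longleftrightarrow> j \<in> B" if "j < i" for j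
    using not_less_Least[of j "\<lambda>i. i \<in> A \<longleftrightarrow> i \<notin> B"] that unfolding i_def by blast
  define F where "F = rat_enum ` {..<i}"
  have layers: "act f b = act g b"
    if L: "layered F f w g" and iso: "isolated_set (range f \<union> range w \<union> range g)"
      and bd: "\<And>x. x \<in> range f \<union> range w \<union> range g \<Longrightarrow> \<bar>x\<bar> \<le> c" for f w g c
  proof -
    have move: "act f b = act g b" if "strict_mono k" "k \<circ> tree C = f" "k \<circ> tree D = g"
      "act (tree C) b = act (tree D) b" for k C D
      using that act_comp[of k] strict_in strict_mono_tree assms by metis
    show ?thesis
    \<comment> \<open>The tree without bit \<open>i\<close> is the lower layer; otherwise
      \<open>A\<close> and \<open>B\<close> play symmetric roles.\<close>
    proof (cases "i \<in> B")
      case True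
      then show ?thesis
        using layered_image_of_trees[of i A B f w g c] i agree L iso bd move eq unfolding F_def by metis
    next
      case False
      then show ?thesis
        using layered_image_of_trees[of i B A f w g c] i agree L iso bd move eq unfolding F_def by metis
    qed
  qed
  show thesis
  proof (rule that)
    show "finite F" by (simp add: F_def)
    fix f g assume fg: "tame f" "tame g" "\<And>p. p \<in> F \<Longrightarrow> f p = g p"
    from common_upper_layer[OF \<open>finite F\<close> fg]
    obtain w u c where *: "\<And>h. h \<in> {f, g} \<Longrightarrow> layered F h w u"
      "\<And>h. h \<in> {f, g} \<Longrightarrow> isolated_set (range h \<union> range w \<union> range u)"
      "\<And>h x. h \<in> {f, g} \<Longrightarrow> x \<in> range h \<union> range w \<union> range u \<Longrightarrow> \<bar>x\<bar> \<le> c" by blast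
    \<comment> \<open>\<open>f\<close> and \<open>g\<close> may cross, but each lies below the same
      \<open>u\<close>.\<close>
    have "act h b = act u b" if "h \<in> {f, g}" for h
      using layers *(1)[OF that] *(2)[OF that] *(3)[OF that] .
    then show "act f b = act g b" by simp
  qed
qed

text \<open>A left multiple of one fixed tame map is tame, and the left factor can be chosen to
  produce any finite part of \<open>f\<close>.\<close>

lemma tame_approximation:
  assumes "strict_mono f" "finite F"
  obtains g where "tame g" "\<And>p. p \<in> F \<Longrightarrow> g p = f p"
proof -
  obtain k where "strict_mono k" "\<And>p. p \<in> F \<Longrightarrow> k (tree {} p) = f p"
    using finite_strict_mono_extension[of F "tree {}" f] assms strict_mono_tree
    by (metis strict_mono_eq strict_mono_less)
  then show thesis using tame_comp_left[OF _ tame_tree] that[of "k \<circ> tree {}"] by auto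
qed

text \<open>
  The action of tame maps extends continuously to all strictly monotone maps. By closedness the
  extension of the action to \<open>f\<close> is the action of some \<open>g\<close>, and \<open>g = f\<close> because \<open>k \<circ> g = k \<circ> f\<close> for
  tame \<open>k\<close>: the compositions with a tame map are tame.
\<close>

lemma strict_support:
  assumes "b \<in> \<Omega>"
  obtains F where "finite F"
    "\<And>f g. strict_mono f \<Longrightarrow> strict_mono g \<Longrightarrow> (\<And>p. p \<in> F \<Longrightarrow> f p = g p) \<Longrightarrow> act f b = act g b"
proof -
  have "\<exists>F. finite F \<and> (\<forall>f g. tame f \<longrightarrow> tame g \<longrightarrow> (\<forall>p\<in>F. f p = g p) \<longrightarrow> act f c = act g c)"
    if "c \<in> \<Omega>" for c using tame_support[OF that] by metis
  then obtain S where finS: "\<And>c. c \<in> \<Omega> \<Longrightarrow> finite (S c)"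
    and S: "\<And>c f g. c \<in> \<Omega> \<Longrightarrow> tame f \<Longrightarrow> tame g \<Longrightarrow> (\<And>p. p \<in> S c \<Longrightarrow> f p = g p) \<Longrightarrow> act f c = act g c"
    by metis
  have tame_strict: "strict_mono f" if "tame f" for f using that by (simp add: tame_def)
  have extend: "act f c = act h c" if f: "strict_mono f" and c: "c \<in> \<Omega>"
    and h: "tame h" "\<And>p. p \<in> S c \<Longrightarrow> h p = f p" for f h c
  proof -
    \<comment> \<open>The choice is immaterial: all tame maps that agree with \<open>f\<close> on
      \<open>S c\<close> act equally on \<open>c\<close>.\<close>
    define t where "t c = act (SOME h. tame h \<and> (\<forall>p\<in>S c. h p = f p)) c" for c
    have t: "t c = act h c" if "c \<in> \<Omega>" "tame h" "\<And>p. p \<in> S c \<Longrightarrow> h p = f p" for c h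
    proof -
      have "\<exists>h. tame h \<and> (\<forall>p\<in>S c. h p = f p)" using that by blast
      from someI_ex[OF this] show ?thesis using that unfolding t_def by (intro S) auto
    qed
    have "\<exists>g\<in>Es. \<forall>c\<in>\<Omega>. act g c = t c"
    proof (rule act_closed)
      fix B assume B: "finite B" "B \<subseteq> \<Omega>"
      then have "finite (\<Union>c\<in>B. S c)" using finS by blast
      then obtain h where "tame h" "\<And>p. p \<in> (\<Union>c\<in>B. S c) \<Longrightarrow> h p = f p"
        using tame_approximation[OF f] by blast
      then have "\<forall>c\<in>B. act h c = t c" using B t[of _ h] by (metis UN_I subsetD)
      then show "\<exists>g\<in>Es. \<forall>c\<in>B. act g c = t c" using \<open>tame h\<close> tame_strict strict_in by blast
    qed
    then obtain g where g: "g \<in> Es" "\<And>c. c \<in> \<Omega> \<Longrightarrow> act g c = t c" by blast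
    have k: "tree {} \<in> Es" using strict_in strict_mono_tree by blast
    have "tree {} \<circ> g = tree {} \<circ> f"
    proof (rule act_faithful)
      fix c assume c: "c \<in> \<Omega>"
      obtain h where h: "tame h" "\<And>p. p \<in> S c \<Longrightarrow> h p = f p"
        using tame_approximation[OF f finS[OF c]] by blast
      have "act (tree {} \<circ> g) c = act (tree {}) (act h c)"
        using act_comp[OF k g(1) c] g(2)[OF c] t[OF c h] by simp
      also have "\<dots> = act (tree {} \<circ> h) c"
        using act_comp[OF k _ c] strict_in tame_strict h(1) by metis
      also have "\<dots> = act (tree {} \<circ> f) c"
        using c h f tame_tree tame_strict by (intro S tame_comp_right) auto
      finally show "act (tree {} \<circ> g) c = act (tree {} \<circ> f) c" .
    qed (use comp_in k g strict_in f in auto)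
    then have "g x = f x" for x
      using strict_mono_eq[OF strict_mono_tree] by (metis comp_apply)
    then have "g = f" by blast
    then show ?thesis using g(2)[OF c] t[OF c h] by simp
  qed
  show thesis
  proof (rule that)
    show "finite (S b)" using finS assms by blast
    fix f g :: "rat \<Rightarrow> rat" assume fg: "strict_mono f" "strict_mono g" "\<And>p. p \<in> S b \<Longrightarrow> f p = g p"
    obtain h where "tame h" "\<And>p. p \<in> S b \<Longrightarrow> h p = f p"
      using tame_approximation[OF fg(1) finS[OF assms]] by blast
    then show "act f b = act g b"
      using extend[OF fg(1) assms, of h] extend[OF fg(2) assms, of h] fg(3) by simp
  qed
qed

text \<open>
  A point \<open>b\<close> that is moved has a nonempty minimal support \<open>F\<close>, and \<open>act f b\<close> determines \<open>f\<close> on \<open>F\<close>: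
  if \<open>act f b = act g b\<close> and \<open>f x \<notin> g ` F\<close> with \<open>x \<in> F\<close>, then maps that agree on \<open>g ` F\<close> but move \<open>f x\<close>
  show that \<open>F - {x}\<close> supports \<open>b\<close>.
\<close>

lemma strict_determined:
  obtains B where "finite B" "B \<subseteq> \<Omega>"
    "\<And>f g. strict_mono f \<Longrightarrow> strict_mono g \<Longrightarrow> (\<And>b. b \<in> B \<Longrightarrow> act f b = act g b) \<Longrightarrow> f q = g q"
proof -
  define supp where "supp F b \<longleftrightarrow> (\<forall>f g. strict_mono f \<longrightarrow> strict_mono g \<longrightarrow> (\<forall>p\<in>F. f p = g p) \<longrightarrow> act f b = act g b)"
    for F and b
  have "\<exists>b\<in>\<Omega>. \<not> supp {} b"
  proof (rule ccontr)
    assume "\<not> ?thesis"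
    \<comment> \<open>If every point had empty support, the identity and a bounded map would act
      equally everywhere.\<close>
    then have "id = tree {}"
      using strict_mono_tree strict_in by (intro act_faithful) (auto simp: supp_def strict_mono_id)
    then have "tree {} 6 = 6" by (metis id_apply)
    then show False using tree_bound[of "{}" 6] by simp
  qed
  then obtain b where b: "b \<in> \<Omega>" "\<not> supp {} b" by blast
  define n where "n = (LEAST n. \<exists>F. finite F \<and> card F = n \<and> supp F b)"
  have "\<exists>n F. finite F \<and> card F = n \<and> supp F b" using strict_support[OF b(1)] unfolding supp_def by metis
  then have "\<exists>F. finite F \<and> card F = n \<and> supp F b" unfolding n_def by (rule LeastI_ex)
  then obtain F where F: "finite F" "card F = n" "supp F b" by blast
  have minimal: "\<not> supp G b" if "finite G" "card G < n" for G
    using not_less_Least[of "card G" "\<lambda>n. \<exists>F. finite F \<and> card F = n \<and> supp F b"] that unfolding n_def by blast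
  have image: "f ` F \<subseteq> g ` F" if fg: "strict_mono f" "strict_mono g" "act f b = act g b" for f g
  proof (rule ccontr)
    assume "\<not> ?thesis"
    then obtain x where x: "x \<in> F" "f x \<notin> g ` F" by blast
    have "supp (F - {x}) b"
      unfolding supp_def
    proof (intro allI impI)
      fix d e :: "rat \<Rightarrow> rat" assume d: "strict_mono d" and e: "strict_mono e" and de: "\<forall>p\<in>F - {x}. d p = e p"
      define N where "N = f ` (F - {x}) \<union> g ` F"
      have "finite N" using F by (simp add: N_def)
      have "f x \<notin> N" using x fg by (auto simp: N_def strict_mono_eq)
      \<comment> \<open>Inside this interval a map can be changed at \<open>f x\<close> without
        changing its values on \<open>f\<close> (F - {x})\<open>and on\<close>g
        \<open>F\<close>.\<close>
      obtain l r where lr: "l < f x" "f x < r" "\<And>y. y \<in> N \<Longrightarrow> y < l \<or> r < y"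
      proof -
        have "\<exists>l r. l < f x \<and> f x < r \<and> (\<forall>y\<in>N. y < l \<or> r < y)" using \<open>finite N\<close> \<open>f x \<notin> N\<close>
        proof (induction N)
          case empty
          then show ?case using gt_ex lt_ex by blast
        next
          case (insert y N)
          then obtain l r where *: "l < f x" "f x < r" "\<forall>y\<in>N. y < l \<or> r < y" by auto
          show ?case
          proof (cases "y < f x")
            case True
            then obtain l' where "max l y < l'" "l' < f x" using dense[of "max l y" "f x"] * by auto
            then show ?thesis using * by (intro exI[of _ l'] exI[of _ r]) auto
          next
            case False
            then have "f x < min r y" using insert * by auto
            then obtain r' where "f x < r'" "r' < min r y" using dense by blast
            then show ?thesis using * by (intro exI[of _ l] exI[of _ r']) auto
          qed
        qed
        then show thesis using that by blast
      qed
      \<comment> \<open>Since \<open>d\<close> and \<open>e\<close> agree on \<open>F - {x}\<close>,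
        all of \<open>L\<close> lies below both \<open>d x\<close> and \<open>e x\<close>, and
        \<open>R\<close> above both. So one pair \<open>l' < r'\<close> can enclose the two
        values.\<close>
      define L where "L = {d p |p. p \<in> F \<and> p < x}"
      define R where "R = {d p |p. p \<in> F \<and> x < p}"
      have LR: "finite L" "finite R" using F by (auto simp: L_def R_def)
      have L: "y < d x \<and> y < e x" if "y \<in> L" for y
        using that d e de by (auto simp: L_def strict_mono_less)
      have R: "d x < y \<and> e x < y" if "y \<in> R" for y
        using that d e de by (auto simp: R_def strict_mono_less)
      have "\<exists>a b. a < b \<and> (\<forall>y\<in>L. y \<le> a) \<and> (\<forall>y\<in>{min (d x) (e x)}. b \<le> y)"
        by (rule finite_sets_gap) (use LR L in \<open>auto simp: min_def\<close>)
      then obtain l1 l2 where l: "l1 < l2" "\<forall>y\<in>L. y \<le> l1" "l2 \<le> min (d x) (e x)" by blast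
      have "\<exists>a b. a < b \<and> (\<forall>y\<in>{max (d x) (e x)}. y \<le> a) \<and> (\<forall>y\<in>R. b \<le> y)"
        by (rule finite_sets_gap) (use LR R in \<open>auto simp: max_def\<close>)
      then obtain r1 r2 where r: "r1 < r2" "max (d x) (e x) \<le> r1" "\<forall>y\<in>R. r2 \<le> y" by blast
      obtain l' where l': "l1 < l'" "l' < l2" using dense l by blast
      obtain r' where r': "r1 < r'" "r' < r2" using dense r by blast
      \<comment> \<open>\<open>k\<close> is to carry \<open>f\<close> to \<open>d\<close> on
        \<open>F - {x}\<close> and the ends of the free interval, indexed by \<open>True\<close> and
        \<open>False\<close>, to \<open>l'\<close> and \<open>r'\<close>.\<close>
      define t where "t i = (case i of Inl p \<Rightarrow> f p | Inr b \<Rightarrow> if b then l else r)" for i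
      define v where "v i = (case i of Inl p \<Rightarrow> d p | Inr b \<Rightarrow> if b then l' else r')" for i
      have side: "(p < x \<longrightarrow> f p < l \<and> d p < l') \<and> (x < p \<longrightarrow> r < f p \<and> r' < d p)" if p: "p \<in> F - {x}" for p
      proof -
        have "f p \<in> N" using p by (auto simp: N_def)
        then have "f p < l \<or> r < f p" using lr by blast
        moreover have "f p < f x \<longleftrightarrow> p < x" "f x < f p \<longleftrightarrow> x < p" using fg by (auto simp: strict_mono_less)
        moreover have "d p \<in> L" if "p < x" using p that by (auto simp: L_def)
        moreover have "d p \<in> R" if "x < p" using p that by (auto simp: R_def)
        ultimately show ?thesis using lr l l' r r' by force
      qed
      define I :: "(rat + bool) set" where "I = Inl ` (F - {x}) \<union> range Inr"
      have order: "t i < t j \<and> v i < v j \<or> t j < t i \<and> v j < v i \<or> i = j" if ij: "i \<in> I" "j \<in> I" for i j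
      proof -
        have lr': "l < r" "l' < r'" using lr l l' r r' by auto
        have side': "f p < l \<and> f p < r \<and> d p < l' \<and> d p < r' \<or> l < f p \<and> r < f p \<and> l' < d p \<and> r' < d p"
          if "p \<in> F - {x}" for p using side[OF that] that lr' by (cases "p < x") auto
        have both: "f p < f p' \<and> d p < d p' \<or> f p' < f p \<and> d p' < d p \<or> p = p'" for p p'
          using d fg by (auto simp: strict_mono_less)
        consider p p' where "i = Inl p" "j = Inl p'" | p b where "i = Inl p" "j = Inr b" "p \<in> F - {x}"
          | p b where "i = Inr b" "j = Inl p" "p \<in> F - {x}" | b b' where "i = Inr b" "j = Inr b'"
          using ij unfolding I_def by blast
        then show ?thesis
        proof cases
          case (1 p p')
          then show ?thesis using both[of p p'] by (simp add: t_def v_def)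
        next
          case (2 p b)
          then show ?thesis using side'[of p] by (auto simp: t_def v_def)
        next
          case (3 p b)
          then show ?thesis using side'[of p] by (auto simp: t_def v_def)
        next
          case (4 b b')
          then show ?thesis using lr' by (simp add: t_def v_def)
        qed
      qed
      obtain k where k: "strict_mono k" "\<And>i. i \<in> I \<Longrightarrow> k (t i) = v i"
      proof (rule finite_strict_mono_extension[of I t v])
        show "finite I" using F by (simp add: I_def)
        show "v i < v j" if "i \<in> I" "j \<in> I" "t i < t j" for i j
          using order[of i j] that by auto
        show "v i = v j" if "i \<in> I" "j \<in> I" "t i = t j" for i j
          using order[of i j] that by auto
      qed blast
      have kp: "k (f p) = d p" if "p \<in> F - {x}" for p using k(2)[of "Inl p"] that by (auto simp: I_def t_def v_def)
      have kl: "k l = l'" using k(2)[of "Inr True"] by (auto simp: I_def t_def v_def)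
      have kr: "k r = r'" using k(2)[of "Inr False"] by (auto simp: I_def t_def v_def)
      have move: "\<exists>k'. strict_mono k' \<and> (\<forall>y. y < l \<or> r < y \<longrightarrow> k' y = k y) \<and> k' (f x) = c" if c: "c \<in> {d x, e x}" for c
      proof -
        \<comment> \<open>\<open>k\<close> is kept outside the free interval and \<open>f x\<close>
          is sent to \<open>c\<close>. This leaves two gaps, to the left and to the right of
          \<open>f x\<close>, and both have room as \<open>l' < c < r'\<close>.\<close>
        define J where "J = {y. y \<le> l \<or> y = f x \<or> r \<le> y}"
        define v where "v y = (if y = f x then c else k y)" for y
        have c: "l' < c" "c < r'" using c l l' r r' by auto
        have less: "v y < v z" if "y \<in> J" "z \<in> J" "y < z" for y z
        proof -
          have "k y < k z" "y \<le> l \<Longrightarrow> k y \<le> l'" "r \<le> z \<Longrightarrow> r' \<le> k z"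
            using k(1) that kl kr by (auto simp: strict_mono_less strict_mono_less_eq)
          then show ?thesis using that c lr by (auto simp: v_def J_def)
        qed
        have fx: "f x \<in> J" "v (f x) = c" by (auto simp: J_def v_def)
        obtain k' where "strict_mono k'" "\<And>y. y \<in> J \<Longrightarrow> k' y = v y"
        proof (rule strict_mono_extension[of J "\<lambda>y. y" v])
          fix z assume "z \<notin> (\<lambda>y. y) ` J"
          then have z: "z \<notin> J" by simp
          show "\<exists>u w. u < w \<and> (\<forall>i\<in>J. i < z \<longrightarrow> v i \<le> u) \<and> (\<forall>i\<in>J. z < i \<longrightarrow> w \<le> v i)"
          proof (cases "z < f x")
            case True
            have "i \<le> l" if "i \<in> J" "i < z" for i using that z True lr by (auto simp: J_def)
            then have "\<forall>i\<in>J. i < z \<longrightarrow> v i \<le> l'"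
              using lr k(1) by (force simp: v_def kl[symmetric] strict_mono_less_eq)
            moreover have "f x \<le> i" if "i \<in> J" "z < i" for i using that z True lr by (auto simp: J_def)
            then have "\<forall>i\<in>J. z < i \<longrightarrow> c \<le> v i"
              using less[OF fx(1)] fx(2) by (metis le_less)
            ultimately show ?thesis using c by blast
          next
            case False
            have "i \<le> f x" if "i \<in> J" "i < z" for i using that z False lr by (auto simp: J_def)
            then have "\<forall>i\<in>J. i < z \<longrightarrow> v i \<le> c"
              using less[OF _ fx(1)] fx(2) by (metis le_less)
            moreover have "r \<le> i" if "i \<in> J" "z < i" for i using that z False lr by (auto simp: J_def)
            then have "\<forall>i\<in>J. z < i \<longrightarrow> r' \<le> v i"
              using lr k(1) by (force simp: v_def kr[symmetric] strict_mono_less_eq)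
            ultimately show ?thesis using c by blast
          qed
        qed (use less in blast)+
        then show ?thesis using lr by (intro exI[of _ k']) (auto simp: J_def v_def)
      qed
      obtain kd where kd: "strict_mono kd" "\<forall>y. y < l \<or> r < y \<longrightarrow> kd y = k y" "kd (f x) = d x"
        using move[of "d x"] by auto
      obtain ke where ke: "strict_mono ke" "\<forall>y. y < l \<or> r < y \<longrightarrow> ke y = k y" "ke (f x) = e x"
        using move[of "e x"] by auto
      have N: "kd y = k y \<and> ke y = k y" if "y \<in> N" for y using lr(3)[OF that] kd ke by auto
      have Fd: "kd (f p) = d p \<and> ke (f p) = e p" if "p \<in> F" for p
        using that kd ke kp[of p] N[of "f p"] de by (cases "p = x") (auto simp: N_def)
      have S: "act u b = act w b" if "strict_mono u" "strict_mono w" "\<And>p. p \<in> F \<Longrightarrow> u p = w p" for u w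
        using F(3) that unfolding supp_def by blast
      have cg: "act (h \<circ> f) b = act (h \<circ> g) b" if "strict_mono h" for h
        using act_comp[OF strict_in strict_in b(1)] that fg by simp
      \<comment> \<open>On \<open>F\<close> the maps \<open>kd \<circ> f\<close> and
        \<open>ke \<circ> f\<close> are \<open>d\<close> and \<open>e\<close>, while
        \<open>kd \<circ> g\<close> and \<open>ke \<circ> g\<close> agree. Passing from
        \<open>f\<close> to \<open>g\<close> and back therefore exchanges \<open>kd\<close> for
        \<open>ke\<close>.\<close>
      have "act d b = act (kd \<circ> f) b"
        using d kd(1) fg(1) Fd by (intro S) (simp_all add: strict_mono_o)
      also have "\<dots> = act (kd \<circ> g) b" by (rule cg[OF kd(1)])
      also have "\<dots> = act (ke \<circ> g) b"
        using fg(2) kd(1) ke(1) N by (intro S) (simp_all add: strict_mono_o N_def)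
      also have "\<dots> = act (ke \<circ> f) b" by (rule cg[OF ke(1), symmetric])
      also have "\<dots> = act e b"
        using e ke(1) fg(1) Fd by (intro S) (simp_all add: strict_mono_o)
      finally show "act d b = act e b" .
    qed
    moreover have "card (F - {x}) < n" using x F by (metis card_Diff1_less)
    ultimately show False using minimal F by blast
  qed
  have determined: "f p = g p" if fg: "strict_mono f" "strict_mono g" "act f b = act g b" and p: "p \<in> F" for f g p
  proof -
    have eq: "f ` F = g ` F" using image[OF fg] image[OF fg(2,1) fg(3)[symmetric]] by blast
    \<comment> \<open>Equality of the finite images suffices: a strictly monotone map preserves the
      position of a point, counted from below.\<close>
    have card: "card {y \<in> F. y < x} = card {y \<in> h ` F. y < h x}" if "strict_mono h" for h :: "rat \<Rightarrow> rat" and x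
    proof -
      have "{y \<in> h ` F. y < h x} = h ` {y \<in> F. y < x}" using that by (auto simp: strict_mono_less)
      then show ?thesis using that by (simp add: card_image strict_mono_imp_inj_on)
    qed
    have strict: "card {y \<in> f ` F. y < u} < card {y \<in> f ` F. y < v}" if "u \<in> f ` F" "u < v" for u v
      using that F(1) by (intro psubset_card_mono) auto
    have "card {y \<in> f ` F. y < f p} = card {y \<in> f ` F. y < g p}"
      using card[OF fg(1), of p] card[OF fg(2), of p] eq by simp
    moreover have "f p \<in> f ` F" using p by simp
    moreover have "g p \<in> f ` F" using p unfolding eq by simp
    ultimately have "\<not> f p < g p" "\<not> g p < f p"
      using strict[of "f p" "g p"] strict[of "g p" "f p"] by auto
    then show ?thesis by simp
  qed
  have "F \<noteq> {}" using b(2) F(3) by blast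
  then obtain x where "x \<in> F" by blast
  \<comment> \<open>A translation moves the point \<open>x\<close> of the support to
    \<open>q\<close>; hence \<open>act s b\<close> detects values at \<open>q\<close>.\<close>
  define s where "s y = y + (q - x)" for y :: rat
  have s: "strict_mono s" "s x = q" by (auto simp: s_def strict_mono_def)
  show thesis
  proof (rule that)
    show "finite {act s b}" "{act s b} \<subseteq> \<Omega>" using act_in b s strict_in by auto
    fix f g :: "rat \<Rightarrow> rat"
    assume fg: "strict_mono f" "strict_mono g" and "\<And>c. c \<in> {act s b} \<Longrightarrow> act f c = act g c"
    then have "act f (act s b) = act g (act s b)" by blast
    then have "act (f \<circ> s) b = act (g \<circ> s) b"
      using act_comp[OF strict_in strict_in b(1)] fg s by simp
    then have "(f \<circ> s) x = (g \<circ> s) x" using determined fg s \<open>x \<in> F\<close> strict_mono_o by blast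
    then show "f q = g q" using s by simp
  qed
qed

end

section \<open>Monotone maps as retracts of strictly monotone maps\<close>

text \<open>The bounded tree is cut into blocks: over the points with floor n the values stay within
  6 of 20 n, and the spacing 20 keeps blocks apart. Unboundedness puts points of the image on both
  sides of every rational.\<close>

lemma unbounded_embedding:
  obtains T :: "rat \<Rightarrow> rat" where "\<And>x. \<exists>\<epsilon>>0. \<forall>y>x. T x + \<epsilon> \<le> T y"
    "\<And>z. \<exists>F. finite F \<and> (\<forall>q r. T q < z \<longrightarrow> z < T r \<longrightarrow> (\<exists>x\<in>F. q \<le> x \<and> x \<le> r))"
    "\<And>z. \<exists>x. T x < z" "\<And>z. \<exists>x. z < T x"
proof
  define T where "T x = 20 * of_int \<lfloor>x\<rfloor> + tree {} x" for x :: rat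
  have bd: "tree {} x < 6" "- 6 < tree {} x" for x using tree_bound[of "{}" x] by auto
  show "\<exists>\<epsilon>>0. \<forall>y>x. T x + \<epsilon> \<le> T y" for x
  proof -
    obtain \<epsilon> where \<epsilon>: "\<epsilon> > 0" "\<And>y. y \<noteq> x \<Longrightarrow> \<epsilon> \<le> \<bar>tree {} y - tree {} x\<bar>"
      using tame_tree[of "{}"] isolated_point[of "tree {}" x] unfolding tame_def by blast
    have "T x + \<epsilon> \<le> T y" if "y > x" for y
    proof -
      have "tree {} x < tree {} y" using that strict_mono_tree by (simp add: strict_mono_less)
      moreover have "\<lfloor>x\<rfloor> \<le> \<lfloor>y\<rfloor>" using that by (simp add: floor_mono)
      ultimately show ?thesis using \<epsilon>(2)[of y] that by (simp add: T_def)
    qed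
    then show ?thesis using \<epsilon> by blast
  qed
  show "\<exists>F. finite F \<and> (\<forall>q r. T q < z \<longrightarrow> z < T r \<longrightarrow> (\<exists>x\<in>F. q \<le> x \<and> x \<le> r))" for z
  proof -
    \<comment> \<open>A cut at \<open>z\<close> inside one block can occur only in block
      \<open>m\<close> or \<open>m + 1\<close>, where it is a cut of the tree; across blocks one of
      the integers \<open>m\<close>, \<open>m + 1\<close>, \<open>m + 2\<close> lies
      between.\<close>
    define m where "m = \<lfloor>z / 20\<rfloor>"
    have m: "20 * of_int m \<le> z" "z < 20 * of_int m + 20"
      using floor_correct[of "z / 20"] by (simp_all add: m_def)
    have "\<exists>F. finite F \<and> (\<forall>q r. tree {} q < u \<longrightarrow> u < tree {} r \<longrightarrow> (\<exists>x\<in>F. q \<le> x \<and> x \<le> r))" for u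
      using tree_rational_cut[of "{}" u] by metis
    then obtain G where G: "\<And>u. finite (G u)"
      "\<And>u q r. tree {} q < u \<Longrightarrow> u < tree {} r \<Longrightarrow> \<exists>x\<in>G u. q \<le> x \<and> x \<le> r" by metis
    define F where "F = G (z - 20 * of_int m) \<union> G (z - 20 * of_int (m + 1))
      \<union> {of_int m, of_int (m + 1), of_int (m + 2)}"
    have "\<exists>x\<in>F. q \<le> x \<and> x \<le> r" if qr: "T q < z" "z < T r" for q r
    proof -
      have "of_int \<lfloor>q\<rfloor> < (of_int (m + 2) :: rat)" "of_int (m - 1) < (of_int \<lfloor>r\<rfloor> :: rat)"
        using qr m bd[of q] bd[of r] by (auto simp: T_def)
      then have mq: "\<lfloor>q\<rfloor> \<le> m + 1" "m \<le> \<lfloor>r\<rfloor>" unfolding of_int_less_iff by simp_all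
      have "q < r"
      proof (rule ccontr)
        assume "\<not> q < r"
        then have "tree {} r \<le> tree {} q" "\<lfloor>r\<rfloor> \<le> \<lfloor>q\<rfloor>"
          using strict_mono_tree by (simp_all add: strict_mono_less_eq floor_mono)
        then show False using qr by (simp add: T_def)
      qed
      then have "\<lfloor>q\<rfloor> \<le> \<lfloor>r\<rfloor>" by (simp add: floor_mono)
      then consider "\<lfloor>q\<rfloor> = \<lfloor>r\<rfloor>" | n where "\<lfloor>q\<rfloor> < n" "n \<le> \<lfloor>r\<rfloor>" "n \<in> {m, m + 1, m + 2}"
        using mq by (cases "\<lfloor>q\<rfloor> = \<lfloor>r\<rfloor>") (auto, smt (verit))
      then show ?thesis
      proof cases
        case 1
        then have "tree {} q < z - 20 * of_int \<lfloor>q\<rfloor>" "z - 20 * of_int \<lfloor>q\<rfloor> < tree {} r"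
          using qr by (auto simp: T_def)
        moreover have "\<lfloor>q\<rfloor> = m \<or> \<lfloor>q\<rfloor> = m + 1" using 1 mq by linarith
        ultimately show ?thesis using G(2) unfolding F_def by (metis UnI1 UnI2)
      next
        case (2 n)
        then have "q \<le> of_int n" "of_int n \<le> r" by linarith+
        then show ?thesis using 2 unfolding F_def by auto
      qed
    qed
    moreover have "finite F" using G by (simp add: F_def)
    ultimately show ?thesis by blast
  qed
  show "\<exists>x. T x < z" for z
  proof (intro exI)
    have "of_int \<lfloor>z / 20\<rfloor> \<le> z / 20" by (rule of_int_floor_le)
    then show "T (of_int (\<lfloor>z / 20\<rfloor> - 1)) < z" using bd[of "of_int (\<lfloor>z / 20\<rfloor> - 1)"] by (simp add: T_def)
  qed
  show "\<exists>x. z < T x" for z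
  proof (intro exI)
    have "z / 20 < of_int \<lfloor>z / 20\<rfloor> + 1" using floor_correct[of "z / 20"] by simp
    then show "z < T (of_int (\<lfloor>z / 20\<rfloor> + 2))" using bd[of "of_int (\<lfloor>z / 20\<rfloor> + 2)"] by (simp add: T_def)
  qed
qed

text \<open>\<open>\<theta>\<close> embeds the lexicographic square of the rationals, with the fibre
  over \<open>x\<close> placed in the gap just to the right of \<open>T x\<close>. The first
  projection extends to all rationals: \<open>z\<close> goes to the last \<open>x\<close> with
  \<open>T x \<le> z\<close> or, failing this, to the first \<open>x\<close> with
  \<open>z < T x\<close>.\<close>

lemma lexicographic_retraction:
  "\<exists>(p :: rat \<Rightarrow> rat) (\<theta> :: rat \<Rightarrow> rat \<Rightarrow> rat). mono p \<and> (\<forall>x y. p (\<theta> x y) = x) \<and>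
    (\<forall>x y x' y'. x < x' \<or> x = x' \<and> y < y' \<longrightarrow> \<theta> x y < \<theta> x' y')"
proof -
  obtain T :: "rat \<Rightarrow> rat" where gap: "\<And>x. \<exists>\<epsilon>>0. \<forall>y>x. T x + \<epsilon> \<le> T y"
    and cut: "\<And>z. \<exists>F. finite F \<and> (\<forall>q r. T q < z \<longrightarrow> z < T r \<longrightarrow> (\<exists>x\<in>F. q \<le> x \<and> x \<le> r))"
    and unbounded: "\<And>z. \<exists>x. T x < z" "\<And>z. \<exists>x. z < T x"
    using unbounded_embedding by blast
  obtain e where e: "\<And>x. e x > 0" "\<And>x y. x < y \<Longrightarrow> T x + e x \<le> T y" using gap by metis
  have T: "T x < T y" if "x < y" for x y using e[of x] e(2)[OF that] by (smt (verit) less_add_same_cancel1 order_less_le_trans)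
  define top where "top z x \<longleftrightarrow> T x \<le> z \<and> (\<forall>y. T y \<le> z \<longrightarrow> y \<le> x)" for z x
  define bot where "bot z x \<longleftrightarrow> z < T x \<and> (\<forall>y. z < T y \<longrightarrow> x \<le> y)" for z x
  \<comment> \<open>Without such a neighbour, image points approach \<open>z\<close> from both sides
    and pass every point of the finite set from \<open>cut\<close>.\<close>
  have adjacent: "\<exists>x. top z x \<or> bot z x" for z
  proof (rule ccontr)
    assume neither: "\<not> ?thesis"
    have notT: "T x \<noteq> z" for x
    proof
      assume "T x = z"
      then have "top z x" unfolding top_def using T by (meson leD leI order_refl)
      then show False using neither by blast
    qed
    obtain F where F: "finite F" "\<And>q r. T q < z \<Longrightarrow> z < T r \<Longrightarrow> \<exists>x\<in>F. q \<le> x \<and> x \<le> r"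
      using cut by blast
    have "\<exists>q. T q < z \<and> (\<forall>x\<in>L. x < q)" if "finite L" "L \<subseteq> {x. T x < z}" for L
      using that
    proof (induction L)
      case (insert x L)
      then obtain q where "T q < z" "\<forall>x\<in>L. x < q" by auto
      moreover obtain y where "T y < z" "x < y"
        using neither insert.prems notT unfolding top_def by (metis insert_subset leI less_imp_le mem_Collect_eq order_le_less)
      ultimately show ?case by (intro exI[of _ "max q y"]) (auto simp: max_def)
    qed (use unbounded in auto)
    from this[of "{x \<in> F. T x < z}"] F(1)
    obtain q where q: "T q < z" "\<forall>x\<in>F. T x < z \<longrightarrow> x < q" by auto
    have "\<exists>q. z < T q \<and> (\<forall>x\<in>L. q < x)" if "finite L" "L \<subseteq> {x. z < T x}" for L
      using that
    proof (induction L)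
      case (insert x L)
      then obtain q where "z < T q" "\<forall>x\<in>L. q < x" by auto
      moreover obtain y where "z < T y" "y < x"
        using neither insert.prems unfolding bot_def by (metis insert_subset leI mem_Collect_eq)
      ultimately show ?case by (intro exI[of _ "min q y"]) (auto simp: min_def)
    qed (use unbounded in auto)
    from this[of "{x \<in> F. z < T x}"] F(1)
    obtain r where r: "z < T r" "\<forall>x\<in>F. z < T x \<longrightarrow> r < x" by auto
    obtain x where "x \<in> F" "q \<le> x" "x \<le> r" using F q r by blast
    then show False using q r notT by (metis linorder_cases not_le)
  qed
  define p where "p z = (if \<exists>x. top z x then SOME x. top z x else SOME x. bot z x)" for z
  have p: "top z (p z) \<or> bot z (p z)" for z
    using adjacent[of z] unfolding p_def by (metis someI)
  have top_unique: "x = y" if "top z x" "top z y" for z x y using that by (auto simp: top_def intro: antisym)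
  have p_top: "p z = x" if "top z x" for z x
    using that top_unique unfolding p_def by (metis someI)
  have p_bot: "p z = x" if "bot z x" "\<not> (\<exists>x. top z x)" for z x
  proof -
    have "bot z (p z)" using p that by blast
    then show ?thesis using that by (auto simp: bot_def intro: antisym)
  qed
  have "p y \<le> p z" if yz: "y \<le> z" for y z
  \<comment> \<open>Either \<open>y\<close> and \<open>z\<close> make the same cut, or some
    \<open>T x\<close> separates them and \<open>p y \<le> x \<le> p z\<close>.\<close>
  proof (cases "\<forall>x. T x \<le> y \<longleftrightarrow> T x \<le> z")
    case True
    then have "top y = top z" "bot y = bot z"
      unfolding top_def bot_def by (auto simp: fun_eq_iff simp flip: not_le)
    then show ?thesis by (simp add: p_def)
  next
    case False
    then obtain x where x: "y < T x" "T x \<le> z" using yz by force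
    have "p y \<le> x" using p[of y] x T unfolding top_def bot_def by (meson le_less_trans less_le_not_le not_le)
    moreover have "x \<le> p z" using p[of z] x T unfolding top_def bot_def by (meson le_less_trans less_le_not_le not_le)
    ultimately show ?thesis by simp
  qed
  then have "mono p" by (rule monoI)
  define \<theta> where "\<theta> x y = T x + e x * squash y" for x y
  have fiber: "T x < \<theta> x y" "\<theta> x y < T x + e x" for x y
    using e(1)[of x] squash_bounds[of y] by (auto simp: \<theta>_def)
  have "top (\<theta> x y) x" for x y
    unfolding top_def using fiber[of x y] e(2) by (meson leI less_imp_le less_le_not_le order_trans)
  then have p\<theta>: "p (\<theta> x y) = x" for x y by (rule p_top)
  have \<theta>: "\<theta> x y < \<theta> x' y'" if "x < x' \<or> x = x' \<and> y < y'" for x y x' y'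
    using that
  proof
    assume "x < x'"
    then show ?thesis using fiber e(2) by (meson le_less_trans less_le_trans less_trans)
  next
    assume "x = x' \<and> y < y'"
    then show ?thesis using e(1)[of x] strict_mono_squash by (auto simp: \<theta>_def strict_mono_less)
  qed
  show ?thesis
    by (intro exI[of _ p] exI[of _ \<theta>] conjI allI impI) (rule \<open>mono p\<close> p\<theta> | erule \<theta>)+
qed

section \<open>Clones of essentially unary operations\<close>

lemma in_nlists_iff: "xs \<in> nlists n A \<longleftrightarrow> length xs = n \<and> set xs \<subseteq> A"
  unfolding nlists_def by (rule mem_Collect_eq)

declare nlistsE_length [simp del] nlistsE_set [simp del]

lemma app_in: "f \<in> all_ops A \<Longrightarrow> xs \<in> nlists (arity f) A \<Longrightarrow> app f xs \<in> A"
  by (auto simp: all_ops_def)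

text \<open>\<open>S\<close> is nonempty because a subbasic set fixes the arity only through the
  length of its tuple.\<close>

lemma openin_clone_basic:
  assumes "finite S" "S \<noteq> {}" and S: "S \<subseteq> nlists (arity f) A" and P: "P \<subseteq> all_ops A" "f \<in> P"
  shows "openin (clone_topology A P) {g \<in> P. arity g = arity f \<and> (\<forall>as\<in>S. app g as = app f as)}"
proof -
  have "openin (clone_topology A P) {g \<in> P. arity g = length as \<and> app g as = app f as}" if "as \<in> S" for as
  proof -
    have as: "as \<in> nlists (arity f) A" using that assms(3) by blast
    then have "as \<in> lists A" by (auto simp: in_nlists_iff)
    moreover have "f \<in> all_ops A" using P by blast
    then have "app f as \<in> A" using as by (rule app_in)
    ultimately show ?thesis
      unfolding clone_topology_def by (intro topology_generated_by_Basis) blast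
  qed
  then have "openin (clone_topology A P) (\<Inter>as\<in>S. {g \<in> P. arity g = length as \<and> app g as = app f as})"
    using assms(1,2) by (intro openin_Inter) auto
  moreover have "(\<Inter>as\<in>S. {g \<in> P. arity g = length as \<and> app g as = app f as})
    = {g \<in> P. arity g = arity f \<and> (\<forall>as\<in>S. app g as = app f as)}"
  proof -
    have "length as = arity f" if "as \<in> S" for as using that assms(3) by (auto simp: in_nlists_iff)
    then show ?thesis using assms(2) by auto
  qed
  ultimately show ?thesis by (simp only:)
qed

lemma topspace_clone_topology [simp]: "topspace (clone_topology A P) = P"
  unfolding clone_topology_def topology_generated_by_topspace by blast

lemma openin_clone_nhd:
  assumes "openin (clone_topology A P) U" "f \<in> U"
  shows "\<exists>S. finite S \<and> S \<subseteq> nlists (arity f) A \<and>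
    (\<forall>g\<in>P. arity g = arity f \<longrightarrow> (\<forall>as\<in>S. app g as = app f as) \<longrightarrow> g \<in> U)"
proof -
  have "generate_topology_on (insert P {{f \<in> P. arity f = length as \<and> app f as = b} | as b. as \<in> lists A \<and> b \<in> A}) U"
    using assms(1) by (simp add: clone_topology_def openin_topology_generated_by_iff)
  then show ?thesis using assms(2)
  proof (induction rule: generate_topology_on.induct)
    case (Int U V)
    then obtain S T where "finite S" "S \<subseteq> nlists (arity f) A" "finite T" "T \<subseteq> nlists (arity f) A"
      "\<forall>g\<in>P. arity g = arity f \<longrightarrow> (\<forall>as\<in>S. app g as = app f as) \<longrightarrow> g \<in> U"
      "\<forall>g\<in>P. arity g = arity f \<longrightarrow> (\<forall>as\<in>T. app g as = app f as) \<longrightarrow> g \<in> V" by auto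
    then show ?case by (intro exI[of _ "S \<union> T"]) auto
  next
    case (UN K)
    then obtain k where "k \<in> K" "f \<in> k" by blast
    then show ?case using UN.IH[OF \<open>k \<in> K\<close> \<open>f \<in> k\<close>] by (metis UnionI)
  next
    case (Basis s)
    then consider "s = P" | as b where "as \<in> lists A" "s = {f \<in> P. arity f = length as \<and> app f as = b}" by blast
    then show ?case
    proof cases
      case 1
      then show ?thesis by (intro exI[of _ "{}"]) auto
    next
      case (2 as b)
      then show ?thesis using Basis.prems by (intro exI[of _ "{as}"]) (auto simp: in_nlists_iff)
    qed
  qed simp
qed

lemma replicate_in_nlists: "a \<in> A \<Longrightarrow> replicate n a \<in> nlists n A"
  by (auto simp: in_nlists_iff)

lemma continuous_map_clone_topology:
  assumes P: "P \<subseteq> all_ops A" and "A \<noteq> {}" and h: "h \<in> P \<rightarrow> Q" and ar: "\<And>f. f \<in> P \<Longrightarrow> arity (h f) = arity f"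
    and support: "\<And>f bs. f \<in> P \<Longrightarrow> bs \<in> nlists (arity f) B \<Longrightarrow> \<exists>S. finite S \<and> S \<subseteq> nlists (arity f) A \<and>
      (\<forall>g\<in>P. arity g = arity f \<longrightarrow> (\<forall>as\<in>S. app g as = app f as) \<longrightarrow> app (h g) bs = app (h f) bs)"
  shows "continuous_map (clone_topology A P) (clone_topology B Q) h"
  unfolding continuous_map_def
proof (intro conjI allI impI)
  show "h \<in> topspace (clone_topology A P) \<rightarrow> topspace (clone_topology B Q)" using h by simp
  fix U assume U: "openin (clone_topology B Q) U"
  show "openin (clone_topology A P) {x \<in> topspace (clone_topology A P). h x \<in> U}"
  proof (subst openin_subopen, safe)
    fix f assume "f \<in> topspace (clone_topology A P)" "h f \<in> U"
    then have f: "f \<in> P" by simp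
    obtain a where a: "a \<in> A" using \<open>A \<noteq> {}\<close> by blast
    obtain T where T: "finite T" "T \<subseteq> nlists (arity f) B"
      "\<forall>g\<in>Q. arity g = arity f \<longrightarrow> (\<forall>bs\<in>T. app g bs = app (h f) bs) \<longrightarrow> g \<in> U"
      using openin_clone_nhd[OF U \<open>h f \<in> U\<close>] ar[OF f] by auto
    have "\<forall>bs\<in>T. \<exists>S. finite S \<and> S \<subseteq> nlists (arity f) A \<and>
      (\<forall>g\<in>P. arity g = arity f \<longrightarrow> (\<forall>as\<in>S. app g as = app f as) \<longrightarrow> app (h g) bs = app (h f) bs)"
      using support[OF f] T by blast
    then obtain S where S: "\<And>bs. bs \<in> T \<Longrightarrow> finite (S bs)" "\<And>bs. bs \<in> T \<Longrightarrow> S bs \<subseteq> nlists (arity f) A"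
      "\<And>bs g. bs \<in> T \<Longrightarrow> g \<in> P \<Longrightarrow> arity g = arity f \<Longrightarrow> (\<forall>as\<in>S bs. app g as = app f as) \<Longrightarrow> app (h g) bs = app (h f) bs"
      by metis
    \<comment> \<open>The constant tuple ensures that the neighbourhood fixes the arity even if no
      other tuple is required.\<close>
    define S' where "S' = insert (replicate (arity f) a) (\<Union>bs\<in>T. S bs)"
    define V where "V = {g \<in> P. arity g = arity f \<and> (\<forall>as\<in>S'. app g as = app f as)}"
    have "finite S'" using T(1) S(1) by (simp add: S'_def)
    moreover have "S' \<noteq> {}" by (simp add: S'_def)
    moreover have "S' \<subseteq> nlists (arity f) A" using S(2) replicate_in_nlists[OF a] by (auto simp: S'_def)
    ultimately have "openin (clone_topology A P) V"
      unfolding V_def using P f by (rule openin_clone_basic)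
    moreover have "f \<in> V" using f by (simp add: V_def)
    moreover have "h g \<in> U" if "g \<in> V" for g
    proof -
      have g: "g \<in> P" "arity g = arity f" "\<forall>as\<in>S'. app g as = app f as" using that by (auto simp: V_def)
      have "app (h g) bs = app (h f) bs" if "bs \<in> T" for bs
        using S(3)[OF that g(1,2)] g(3) that by (auto simp: S'_def)
      then show ?thesis using T(3) h g ar by (auto simp: Pi_iff)
    qed
    ultimately show "\<exists>T. openin (clone_topology A P) T \<and> f \<in> T \<and> T \<subseteq> {x \<in> topspace (clone_topology A P). h x \<in> U}"
      by (intro exI[of _ V]) (auto simp: V_def)
  qed
qed

lemma closed_clone_limit:
  assumes "closed_clone A P" "t \<in> all_ops A"
    and approx: "\<And>S. finite S \<Longrightarrow> S \<subseteq> nlists (arity t) A \<Longrightarrow> \<exists>f\<in>P. arity f = arity t \<and> (\<forall>as\<in>S. app f as = app t as)"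
  shows "t \<in> P"
proof (rule ccontr)
  assume "t \<notin> P"
  have "openin (clone_topology A (all_ops A)) (all_ops A - P)" "P \<subseteq> all_ops A"
    using assms(1) by (auto simp: closed_clone_def closedin_def)
  then show False using openin_clone_nhd[of A "all_ops A" "all_ops A - P" t] \<open>t \<notin> P\<close> assms(2) approx by blast
qed

lemma closed_cloneI:
  assumes "clone_on A P" "A \<noteq> {}"
    and sep: "\<And>t. t \<in> all_ops A \<Longrightarrow> t \<notin> P \<Longrightarrow> \<exists>S. finite S \<and> S \<subseteq> nlists (arity t) A \<and>
      (\<forall>f\<in>P. arity f = arity t \<longrightarrow> (\<exists>as\<in>S. app f as \<noteq> app t as))"
  shows "closed_clone A P"
  unfolding closed_clone_def closedin_def
proof (intro conjI assms(1))
  show "P \<subseteq> topspace (clone_topology A (all_ops A))" using assms(1) by (simp add: clone_on_def)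
  show "openin (clone_topology A (all_ops A)) (topspace (clone_topology A (all_ops A)) - P)"
  proof (subst openin_subopen, safe)
    fix t assume "t \<in> topspace (clone_topology A (all_ops A))" "t \<notin> P"
    then have t: "t \<in> all_ops A" "t \<notin> P" by auto
    obtain a where a: "a \<in> A" using \<open>A \<noteq> {}\<close> by blast
    obtain S where S: "finite S" "S \<subseteq> nlists (arity t) A"
      "\<forall>f\<in>P. arity f = arity t \<longrightarrow> (\<exists>as\<in>S. app f as \<noteq> app t as)" using sep[OF t] by blast
    define S' where "S' = insert (replicate (arity t) a) S"
    have "openin (clone_topology A (all_ops A)) {g \<in> all_ops A. arity g = arity t \<and> (\<forall>as\<in>S'. app g as = app t as)}"
      using S t replicate_in_nlists[OF a] by (intro openin_clone_basic) (auto simp: S'_def)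
    moreover have "{g \<in> all_ops A. arity g = arity t \<and> (\<forall>as\<in>S'. app g as = app t as)} \<subseteq> all_ops A - P"
      using S(3) by (auto simp: S'_def)
    ultimately show "\<exists>T. openin (clone_topology A (all_ops A)) T \<and> t \<in> T \<and>
        T \<subseteq> topspace (clone_topology A (all_ops A)) - P"
      using t by (intro exI conjI) auto
  qed
qed

definition unary_at :: "nat \<Rightarrow> nat \<Rightarrow> ('a \<Rightarrow> 'a) \<Rightarrow> 'a op" where
  "unary_at n j f = (n, \<lambda>xs\<in>nlists n UNIV. f (xs ! j))"

definition essentially_unary :: "('a \<Rightarrow> 'a) set \<Rightarrow> 'a op set" where
  "essentially_unary E = {unary_at n j f | n j f. j < n \<and> f \<in> E}"

lemma arity_unary_at [simp]: "arity (unary_at n j f) = n"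
  by (simp add: unary_at_def)

lemma app_unary_at [simp]: "length xs = n \<Longrightarrow> app (unary_at n j f) xs = f (xs ! j)"
  by (simp add: unary_at_def in_nlists_iff)

lemma op_eqI:
  assumes "f \<in> all_ops A" "g \<in> all_ops A" "arity f = arity g"
    "\<And>xs. xs \<in> nlists (arity f) A \<Longrightarrow> app f xs = app g xs"
  shows "f = g"
proof (rule prod_eqI)
  show "app f = app g"
    using assms by (intro extensionalityI[of _ "nlists (arity f) A"]) (auto simp: all_ops_def PiE_def)
qed (fact assms)

lemma unary_at_in_all_ops: "unary_at n j f \<in> all_ops UNIV"
  by (simp add: unary_at_def all_ops_def)

lemma unary_op_eq_unary_at: "unary_op UNIV f = unary_at 1 0 f"
proof -
  have "hd xs = xs ! 0" if "length xs = 1" for xs :: "'a list" using that by (cases xs) auto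
  then show ?thesis
    unfolding unary_op_def unary_at_def by (auto simp: in_nlists_iff intro!: restrict_ext)
qed

lemma proj_op_eq_unary_at: "proj_op UNIV n j = unary_at n j id"
  by (simp add: proj_op_def unary_at_def)

lemma comp_op_unary_at:
  assumes "length gs = n" "j < n" "gs ! j = unary_at m i g"
  shows "comp_op UNIV m (unary_at n j f) gs = unary_at m i (f \<circ> g)"
  using assms by (auto simp: comp_op_def unary_at_def fun_eq_iff restrict_def in_nlists_iff)

lemma unary_at_comp: "unary_at n j f = comp_op UNIV n (unary_op UNIV f) [proj_op UNIV n j]"
  using comp_op_unary_at[of "[proj_op UNIV n j]" 1 0 n j id f]
  by (simp add: unary_op_eq_unary_at proj_op_eq_unary_at)

lemma clone_on_comp:
  "clone_on A P \<Longrightarrow> f \<in> P \<Longrightarrow> set gs \<subseteq> P \<Longrightarrow> arity f = length gs \<Longrightarrow>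
    (\<And>g. g \<in> set gs \<Longrightarrow> arity g = m) \<Longrightarrow> comp_op A m f gs \<in> P"
  unfolding clone_on_def by blast

lemma clone_on_essentially_unary:
  assumes "id \<in> E" "\<And>f g. f \<in> E \<Longrightarrow> g \<in> E \<Longrightarrow> f \<circ> g \<in> E"
  shows "clone_on UNIV (essentially_unary E)"
  unfolding clone_on_def
proof (intro conjI allI impI)
  show "essentially_unary E \<subseteq> all_ops UNIV"
    by (auto simp: essentially_unary_def unary_at_in_all_ops)
  show "proj_op UNIV n i \<in> essentially_unary E" if "i < n" for n i
    using that assms by (auto simp: essentially_unary_def proj_op_eq_unary_at)
  fix m f gs
  assume *: "f \<in> essentially_unary E \<and> set gs \<subseteq> essentially_unary E \<and> arity f = length gs \<and> (\<forall>g\<in>set gs. arity g = m)"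
  then obtain j f' where f: "f = unary_at (length gs) j f'" "j < length gs" "f' \<in> E"
    by (auto simp: essentially_unary_def)
  then have "gs ! j \<in> set gs" by simp
  then obtain i g where "gs ! j = unary_at m i g" "i < m" "g \<in> E"
    using * by (force simp: essentially_unary_def)
  then show "comp_op UNIV m f gs \<in> essentially_unary E"
    using f assms(2)[OF f(3)] comp_op_unary_at[of gs "length gs" j m i g f']
    by (auto simp: essentially_unary_def)
qed

text \<open>The right-hand side is itself a clone, and its members are elements of \<open>E\<close>
  composed with projections, so every clone above \<open>E\<close> contains them.\<close>

lemma generated_clone_eq:
  assumes "id \<in> E" "\<And>f g. f \<in> E \<Longrightarrow> g \<in> E \<Longrightarrow> f \<circ> g \<in> E"
  shows "generated_clone UNIV E = essentially_unary E"
proof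
  have "unary_op UNIV ` E \<subseteq> essentially_unary E"
    by (auto simp: essentially_unary_def unary_op_eq_unary_at)
  then show "generated_clone UNIV E \<subseteq> essentially_unary E"
    using clone_on_essentially_unary[OF assms] unfolding generated_clone_def by blast
  show "essentially_unary E \<subseteq> generated_clone UNIV E"
    unfolding generated_clone_def
  proof (intro Inter_greatest subsetI)
    fix P x assume P: "P \<in> {P. clone_on UNIV P \<and> unary_op UNIV ` E \<subseteq> P}" and "x \<in> essentially_unary E"
    then obtain n j f where x: "x = unary_at n j f" "j < n" "f \<in> E" by (auto simp: essentially_unary_def)
    have "clone_on UNIV P" "unary_op UNIV f \<in> P" using P x by auto
    moreover from this have "proj_op UNIV n j \<in> P" using x by (auto simp: clone_on_def)
    moreover have "arity (unary_op UNIV f) = 1" "arity (proj_op UNIV n j) = n"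
      by (simp_all add: unary_op_def proj_op_def)
    ultimately have "comp_op UNIV n (unary_op UNIV f) [proj_op UNIV n j] \<in> P"
      by (intro clone_on_comp) auto
    then show "x \<in> P" using x by (simp add: unary_at_comp)
  qed
qed

text \<open>If the diagonal \<open>d\<close> of \<open>t\<close> is outside \<open>E\<close>,
  constant tuples separate \<open>t\<close>. Otherwise each position \<open>j\<close> is refuted by
  a tuple \<open>X j\<close>, together with the constant tuple of its entry at \<open>j\<close>,
  which ties the unary map to \<open>d\<close> there.\<close>

lemma closed_clone_essentially_unary:
  fixes E :: "('a \<Rightarrow> 'a) set"
  assumes "id \<in> E" "\<And>f g. f \<in> E \<Longrightarrow> g \<in> E \<Longrightarrow> f \<circ> g \<in> E"
    and closed: "\<And>t. (\<And>F. finite F \<Longrightarrow> \<exists>f\<in>E. \<forall>x\<in>F. f x = t x) \<Longrightarrow> t \<in> E"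
  shows "closed_clone UNIV (essentially_unary E)"
proof (rule closed_cloneI)
  show "clone_on UNIV (essentially_unary E)" using assms by (intro clone_on_essentially_unary)
  fix t :: "'a op" assume t: "t \<in> all_ops UNIV" "t \<notin> essentially_unary E"
  define n where "n = arity t"
  define d where "d x = app t (replicate n x)" for x
  have elem: "\<exists>j e. g = unary_at n j e \<and> j < n \<and> e \<in> E" if "g \<in> essentially_unary E" "arity g = n" for g
    using that by (auto simp: essentially_unary_def) blast
  have diag: "e x = d x" if "app (unary_at n j e) (replicate n x) = app t (replicate n x)" "j < n" for j e x
    using that by (simp add: d_def)
  have "\<exists>S. finite S \<and> S \<subseteq> nlists n UNIV \<and> (\<forall>g\<in>essentially_unary E. arity g = n \<longrightarrow> (\<exists>xs\<in>S. app g xs \<noteq> app t xs))"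
  proof (cases "d \<in> E")
    case False
    then obtain F where F: "finite F" "\<And>f. f \<in> E \<Longrightarrow> \<exists>x\<in>F. f x \<noteq> d x" using closed by metis
    have "\<exists>xs\<in>replicate n ` F. app g xs \<noteq> app t xs" if g: "g \<in> essentially_unary E" "arity g = n" for g
    proof -
      obtain j e where je: "g = unary_at n j e" "j < n" "e \<in> E" using elem[OF g] by blast
      then obtain x where "x \<in> F" "e x \<noteq> d x" using F by blast
      then show ?thesis using diag[of j e x] je by blast
    qed
    then show ?thesis using F by (intro exI[of _ "replicate n ` F"]) (auto simp: in_nlists_iff)
  next
    case True
    have "\<exists>xs. length xs = n \<and> app t xs \<noteq> d (xs ! j)" if "j < n" for j
    proof (rule ccontr)
      assume "\<not> ?thesis"
      then have "t = unary_at n j d"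
        using t unary_at_in_all_ops by (intro op_eqI[of _ UNIV]) (auto simp: n_def in_nlists_iff)
      then show False using t True that by (auto simp: essentially_unary_def)
    qed
    then obtain X where X: "\<And>j. j < n \<Longrightarrow> length (X j) = n" "\<And>j. j < n \<Longrightarrow> app t (X j) \<noteq> d (X j ! j)" by metis
    define S where "S = X ` {..<n} \<union> (\<lambda>j. replicate n (X j ! j)) ` {..<n}"
    have "\<exists>xs\<in>S. app g xs \<noteq> app t xs" if g: "g \<in> essentially_unary E" "arity g = n" for g
    proof (rule ccontr)
      assume agree: "\<not> ?thesis"
      obtain j e where je: "g = unary_at n j e" "j < n" "e \<in> E" using elem[OF g] by blast
      have ag: "app (unary_at n j e) xs = app t xs" if "xs \<in> S" for xs using agree je that by blast
      have "e (X j ! j) = app t (X j)" using ag[of "X j"] je X(1) by (simp add: S_def)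
      moreover have "e (X j ! j) = d (X j ! j)"
        by (rule diag[OF ag]) (use je in \<open>simp_all add: S_def\<close>)
      ultimately show False using X(2)[OF je(2)] by simp
    qed
    then show ?thesis using X by (intro exI[of _ S]) (auto simp: S_def in_nlists_iff)
  qed
  then show "\<exists>S. finite S \<and> S \<subseteq> nlists (arity t) UNIV \<and>
      (\<forall>g\<in>essentially_unary E. arity g = arity t \<longrightarrow> (\<exists>xs\<in>S. app g xs \<noteq> app t xs))"
    by (simp add: n_def)
qed simp

lemma clone_hom_comp:
  assumes "clone_hom A P B Q h" "f \<in> P" "set gs \<subseteq> P" "arity f = length gs" "\<And>g. g \<in> set gs \<Longrightarrow> arity g = m"
  shows "h (comp_op A m f gs) = comp_op B m (h f) (map h gs)"
  using assms(1)[unfolded clone_hom_def, THEN conjunct2, THEN conjunct2, THEN conjunct2,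
      THEN spec, THEN spec, THEN spec, THEN mp] assms(2-5) by simp

section \<open>The action induced by a clone isomorphism\<close>

definition unary_action :: "('a op \<Rightarrow> 'b op) \<Rightarrow> ('a \<Rightarrow> 'a) \<Rightarrow> 'b \<Rightarrow> 'b" where
  "unary_action h f b = app (h (unary_op UNIV f)) [b]"

context
  fixes E :: "('a \<Rightarrow> 'a) set" and \<Omega> :: "'b set" and Q h
  assumes id_in: "id \<in> E" and comp_in: "\<And>f g. f \<in> E \<Longrightarrow> g \<in> E \<Longrightarrow> f \<circ> g \<in> E"
    and Q: "closed_clone \<Omega> Q" and iso: "clone_iso UNIV (essentially_unary E) \<Omega> Q h"
begin

lemma unary_at_in: "f \<in> E \<Longrightarrow> j < n \<Longrightarrow> unary_at n j f \<in> essentially_unary E"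
  by (auto simp: essentially_unary_def)

lemma unary_op_in: "f \<in> E \<Longrightarrow> unary_op UNIV f \<in> essentially_unary E"
  by (auto simp: unary_op_eq_unary_at intro!: unary_at_in)

lemma hom: "clone_hom UNIV (essentially_unary E) \<Omega> Q h" "bij_betw h (essentially_unary E) Q"
  using iso by (auto simp: clone_iso_def)

lemma hom_in: "F \<in> essentially_unary E \<Longrightarrow> h F \<in> Q"
  and hom_arity: "F \<in> essentially_unary E \<Longrightarrow> arity (h F) = arity F"
  and hom_proj: "i < n \<Longrightarrow> h (proj_op UNIV n i) = proj_op \<Omega> n i"
  using hom(1) by (auto simp: clone_hom_def)

lemma hom_comp: "F \<in> essentially_unary E \<Longrightarrow> set gs \<subseteq> essentially_unary E \<Longrightarrow> arity F = length gs \<Longrightarrow>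
    (\<And>g. g \<in> set gs \<Longrightarrow> arity g = m) \<Longrightarrow> h (comp_op UNIV m F gs) = comp_op \<Omega> m (h F) (map h gs)"
  by (rule clone_hom_comp[OF hom(1)])

lemma Q_ops: "Q \<subseteq> all_ops \<Omega>"
  using Q by (simp add: closed_clone_def clone_on_def)

lemma unary_action_in: "f \<in> E \<Longrightarrow> b \<in> \<Omega> \<Longrightarrow> unary_action h f b \<in> \<Omega>"
proof -
  assume f: "f \<in> E" and b: "b \<in> \<Omega>"
  have "h (unary_op UNIV f) \<in> all_ops \<Omega>" "arity (h (unary_op UNIV f)) = 1"
    using hom_in[OF unary_op_in[OF f]] Q_ops hom_arity[OF unary_op_in[OF f]] by (auto simp: unary_op_def)
  moreover have "[b] \<in> nlists 1 \<Omega>" using b by (simp add: in_nlists_iff)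
  ultimately show ?thesis unfolding unary_action_def by (metis app_in)
qed

lemma hom_unary_at:
  assumes f: "f \<in> E" and j: "j < n" and bs: "bs \<in> nlists n \<Omega>"
  shows "app (h (unary_at n j f)) bs = unary_action h f (bs ! j)"
proof -
  have "proj_op UNIV n j \<in> essentially_unary E"
    using unary_at_in[OF id_in j] by (simp add: proj_op_eq_unary_at)
  then have "h (unary_at n j f) = comp_op \<Omega> n (h (unary_op UNIV f)) [proj_op \<Omega> n j]"
    using hom_comp[of "unary_op UNIV f" "[proj_op UNIV n j]" n] unary_op_in[OF f] hom_proj[OF j]
    by (simp add: unary_at_comp unary_op_def proj_op_def)
  then show ?thesis using bs by (simp add: comp_op_def proj_op_def unary_action_def)
qed

lemma unary_action_comp:
  assumes f: "f \<in> E" and g: "g \<in> E" and b: "b \<in> \<Omega>"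
  shows "unary_action h (f \<circ> g) b = unary_action h f (unary_action h g b)"
proof -
  have "unary_op UNIV (f \<circ> g) = comp_op UNIV 1 (unary_op UNIV f) [unary_op UNIV g]"
    using comp_op_unary_at[of "[unary_op UNIV g]" 1 0 1 0 g f] by (simp add: unary_op_eq_unary_at)
  also have "h \<dots> = comp_op \<Omega> 1 (h (unary_op UNIV f)) [h (unary_op UNIV g)]"
    using hom_comp[of "unary_op UNIV f" "[unary_op UNIV g]" 1] unary_op_in f g by (simp add: unary_op_def)
  finally show ?thesis using b by (simp add: comp_op_def unary_action_def in_nlists_iff)
qed

lemma hom_ext:
  assumes F: "F \<in> essentially_unary E" and G: "G \<in> essentially_unary E" and ar: "arity F = arity G"
    and eq: "\<And>bs. bs \<in> nlists (arity F) \<Omega> \<Longrightarrow> app (h F) bs = app (h G) bs"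
  shows "F = G"
proof -
  have "h F = h G"
    using hom_in[OF F] hom_in[OF G] Q_ops hom_arity[OF F] hom_arity[OF G] ar eq by (intro op_eqI[of _ \<Omega>]) auto
  then show ?thesis using hom(2) F G by (metis bij_betw_inv_into_left)
qed

lemma unary_action_faithful:
  assumes f: "f \<in> E" and g: "g \<in> E" and eq: "\<And>b. b \<in> \<Omega> \<Longrightarrow> unary_action h f b = unary_action h g b"
  shows "f = g"
proof
  fix x
  have "unary_at 1 0 f = unary_at 1 0 g"
    using f g by (intro hom_ext) (auto simp: unary_at_in hom_unary_at in_nlists_iff intro!: eq)
  then have "app (unary_at 1 0 f) [x] = app (unary_at 1 0 g) [x]" by simp
  then show "f x = g x" by simp
qed

text \<open>The limit is a unary operation in the closed clone \<open>Q\<close>; its preimage under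
  \<open>h\<close> again has arity 1 and so comes from \<open>E\<close>.\<close>

lemma unary_action_closed:
  assumes approx: "\<And>B. finite B \<Longrightarrow> B \<subseteq> \<Omega> \<Longrightarrow> \<exists>f\<in>E. \<forall>b\<in>B. unary_action h f b = t b"
  shows "\<exists>f\<in>E. \<forall>b\<in>\<Omega>. unary_action h f b = t b"
proof -
  define T where "T = (1 :: nat, \<lambda>xs\<in>nlists 1 \<Omega>. t (xs ! 0))"
  have "t b \<in> \<Omega>" if "b \<in> \<Omega>" for b
    using approx[of "{b}"] that unary_action_in by force
  then have "t (xs ! 0) \<in> \<Omega>" if "xs \<in> nlists 1 \<Omega>" for xs
    using nlistsE_nth_in[OF that, of 0] by simp
  then have "T \<in> all_ops \<Omega>" by (auto simp: T_def all_ops_def)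
  moreover have "\<exists>f\<in>Q. arity f = arity T \<and> (\<forall>bs\<in>S. app f bs = app T bs)"
    if S: "finite S" "S \<subseteq> nlists (arity T) \<Omega>" for S
  proof -
    have "finite ((\<lambda>bs. bs ! 0) ` S)" "(\<lambda>bs. bs ! 0) ` S \<subseteq> \<Omega>"
      using S nlistsE_nth_in[of _ 1 \<Omega> 0] by (auto simp: T_def)
    then obtain f where f: "f \<in> E" "\<forall>b\<in>(\<lambda>bs. bs ! 0) ` S. unary_action h f b = t b" using approx by blast
    have "app (h (unary_at 1 0 f)) bs = app T bs" if "bs \<in> S" for bs
      using S that f hom_unary_at[OF f(1), of 0 1 bs] by (auto simp: T_def)
    moreover have "arity (h (unary_at 1 0 f)) = 1" using hom_arity[OF unary_at_in[OF f(1)]] by simp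
    ultimately show ?thesis using hom_in[OF unary_at_in[OF f(1)]]
      by (intro bexI[of _ "h (unary_at 1 0 f)"]) (auto simp: T_def)
  qed
  ultimately have "T \<in> Q" by (rule closed_clone_limit[OF Q])
  then obtain F where F: "F \<in> essentially_unary E" "h F = T" using hom(2) by (auto simp: bij_betw_def)
  then have "arity F = 1" using hom_arity by (metis T_def fst_conv)
  then obtain f where f: "f \<in> E" "F = unary_at 1 0 f" using F(1) by (auto simp: essentially_unary_def)
  have "unary_action h f b = t b" if "b \<in> \<Omega>" for b
    using hom_unary_at[OF f(1), of 0 1 "[b]"] that F(2) f(2) by (simp add: T_def in_nlists_iff)
  then show ?thesis using f by blast
qed

text \<open>
  Constant tuples compare \<open>f\<close> with \<open>g\<close>. If \<open>f u \<noteq> f v\<close>, then the tuple with entry \<open>v\<close> at position \<open>j\<close> and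
  \<open>u\<close> elsewhere forces \<open>i = j\<close>.
\<close>

lemma position_test:
  fixes f :: "'c \<Rightarrow> 'd"
  assumes j: "j < n" and X: "finite X" "X \<subseteq> A"
  obtains S where "finite S" "S \<subseteq> nlists n A"
    "\<And>g i. i < n \<Longrightarrow> (\<And>xs. xs \<in> S \<Longrightarrow> g (xs ! i) = f (xs ! j)) \<Longrightarrow>
      (\<forall>x\<in>X. g x = f x) \<and> (i = j \<or> (\<forall>x\<in>A. \<forall>y\<in>A. f x = f y))"
proof (cases "\<forall>x\<in>A. \<forall>y\<in>A. f x = f y")
  case True
  show thesis
  proof (rule that[of "replicate n ` X"])
    fix g i assume i: "i < n" and S: "\<And>xs. xs \<in> replicate n ` X \<Longrightarrow> g (xs ! i) = f (xs ! j)"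
    have "g x = f x" if "x \<in> X" for x using S[of "replicate n x"] that i j by simp
    then show "(\<forall>x\<in>X. g x = f x) \<and> (i = j \<or> (\<forall>x\<in>A. \<forall>y\<in>A. f x = f y))" using True by blast
  next
    show "replicate n ` X \<subseteq> nlists n A" using X(2) replicate_in_nlists by blast
  qed (use X(1) in simp)
next
  case False
  then obtain u v where uv: "u \<in> A" "v \<in> A" "f u \<noteq> f v" by blast
  define S where "S = insert ((replicate n u)[j := v]) (replicate n ` insert u X)"
  show thesis
  proof (rule that[of S])
    show "finite S" using X by (simp add: S_def)
    have "(replicate n u)[j := v] \<in> nlists n A"
      using uv set_update_subset_insert[of "replicate n u" j v] by (auto simp: in_nlists_iff split: if_splits)
    then show "S \<subseteq> nlists n A" using X(2) uv(1) replicate_in_nlists unfolding S_def by blast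
    fix g i assume i: "i < n" and S: "\<And>xs. xs \<in> S \<Longrightarrow> g (xs ! i) = f (xs ! j)"
    have const: "g x = f x" if "x \<in> insert u X" for x
      using S[of "replicate n x"] that i j by (auto simp: S_def)
    moreover have "i = j"
    proof (rule ccontr)
      assume "i \<noteq> j"
      then have "g u = f v" using S[of "(replicate n u)[j := v]"] i j by (auto simp: S_def)
      then show False using const[of u] uv by simp
    qed
    ultimately show "(\<forall>x\<in>X. g x = f x) \<and> (i = j \<or> (\<forall>x\<in>A. \<forall>y\<in>A. f x = f y))" by blast
  qed
qed

text \<open>\<open>support\<close> yields continuity of \<open>h\<close>, \<open>determined\<close>
  that of its inverse. Finitely many tuples detect the position of the argument unless the unary map
  is constant; then all positions give the same operation.\<close>

lemma homeomorphic_map_of_unary_action: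
  assumes \<Omega>: "\<Omega> \<noteq> {}"
    and support: "\<And>b. b \<in> \<Omega> \<Longrightarrow> \<exists>F. finite F \<and>
      (\<forall>f\<in>E. \<forall>g\<in>E. (\<forall>x\<in>F. g x = f x) \<longrightarrow> unary_action h g b = unary_action h f b)"
    and determined: "\<And>x. \<exists>B. finite B \<and> B \<subseteq> \<Omega> \<and>
      (\<forall>f\<in>E. \<forall>g\<in>E. (\<forall>b\<in>B. unary_action h g b = unary_action h f b) \<longrightarrow> g x = f x)"
  shows "homeomorphic_map (clone_topology UNIV (essentially_unary E)) (clone_topology \<Omega> Q) h"
proof -
  let ?P = "essentially_unary E"
  define k where "k = inv_into ?P h"
  have kh: "k (h F) = F" if "F \<in> ?P" for F
    using hom(2) that by (simp add: k_def bij_betw_inv_into_left)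
  have hk: "h (k G) = G" "k G \<in> ?P" if "G \<in> Q" for G
    using hom(2) that by (auto simp: k_def bij_betw_inv_into_right bij_betw_def inv_into_into)
  have P_ops: "?P \<subseteq> all_ops UNIV" by (auto simp: essentially_unary_def unary_at_in_all_ops)
  have "continuous_map (clone_topology UNIV ?P) (clone_topology \<Omega> Q) h"
  proof (rule continuous_map_clone_topology[OF P_ops])
    fix F bs assume "F \<in> ?P" and bs: "bs \<in> nlists (arity F) \<Omega>"
    then obtain n j f where F: "F = unary_at n j f" "j < n" "f \<in> E" by (auto simp: essentially_unary_def)
    have bs\<Omega>: "bs ! i \<in> \<Omega>" if "i < n" for i using nlistsE_nth_in[OF bs] that F by simp
    have "\<forall>i<n. \<exists>X. finite X \<and>
        (\<forall>f\<in>E. \<forall>g\<in>E. (\<forall>x\<in>X. g x = f x) \<longrightarrow> unary_action h g (bs ! i) = unary_action h f (bs ! i))"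
      using support bs\<Omega> by blast
    then obtain X where X: "\<And>i. i < n \<Longrightarrow> finite (X i)"
      "\<And>i f g. i < n \<Longrightarrow> f \<in> E \<Longrightarrow> g \<in> E \<Longrightarrow> (\<forall>x\<in>X i. g x = f x) \<Longrightarrow> unary_action h g (bs ! i) = unary_action h f (bs ! i)"
      by metis
    \<comment> \<open>The position used by a nearby operation is not known in advance, so the
      supports of all entries of \<open>bs\<close> are collected.\<close>
    have "finite (\<Union>i<n. X i)" using X by blast
    then obtain S where S: "finite S" "S \<subseteq> nlists n UNIV"
      "\<And>g i. i < n \<Longrightarrow> (\<And>xs. xs \<in> S \<Longrightarrow> g (xs ! i) = f (xs ! j)) \<Longrightarrow>
        (\<forall>x\<in>(\<Union>i<n. X i). g x = f x) \<and> (i = j \<or> (\<forall>x\<in>UNIV. \<forall>y\<in>UNIV. f x = f y))"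
      using position_test[OF F(2), of "\<Union>i<n. X i" UNIV f] by blast
    have "app (h G) bs = app (h F) bs"
      if G: "G \<in> ?P" "arity G = arity F" "\<forall>xs\<in>S. app G xs = app F xs" for G
    proof -
      obtain i g where g: "G = unary_at n i g" "i < n" "g \<in> E" using G F by (auto simp: essentially_unary_def)
      have "g (xs ! i) = f (xs ! j)" if "xs \<in> S" for xs
      proof -
        have "length xs = n" using S(2) that by (auto simp: in_nlists_iff)
        moreover have "app G xs = app F xs" using G(3) that by blast
        ultimately show ?thesis using g F by simp
      qed
      note test = S(3)[OF g(2) this]
      have "unary_action h g (bs ! i) = unary_action h f (bs ! i)"
        using test g(2) by (intro X(2) F g) auto
      moreover have "unary_action h f (bs ! i) = unary_action h f (bs ! j)"
      proof (cases "i = j")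
        case False
        then have "unary_at n i f = unary_at n j f" using test by (auto simp: unary_at_def intro!: restrict_ext)
        then show ?thesis using hom_unary_at[OF F(3) g(2), of bs] hom_unary_at[OF F(3,2), of bs] bs F by simp
      qed simp
      ultimately show ?thesis using hom_unary_at[OF g(3,2), of bs] hom_unary_at[OF F(3,2), of bs] bs F g by simp
    qed
    then show "\<exists>S. finite S \<and> S \<subseteq> nlists (arity F) UNIV \<and>
      (\<forall>G\<in>?P. arity G = arity F \<longrightarrow> (\<forall>as\<in>S. app G as = app F as) \<longrightarrow> app (h G) bs = app (h F) bs)"
      using S F by auto
  qed (use hom_in hom_arity in auto)
  moreover have "continuous_map (clone_topology \<Omega> Q) (clone_topology (UNIV :: 'a set) ?P) k"
  proof (rule continuous_map_clone_topology[OF Q_ops \<Omega>])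
    show "k \<in> Q \<rightarrow> ?P" using hk by blast
    show "arity (k G) = arity G" if "G \<in> Q" for G using hk[OF that] hom_arity by metis
    fix F' as assume F': "F' \<in> Q" and as: "as \<in> nlists (arity F') (UNIV :: 'a set)"
    obtain n j f where F: "k F' = unary_at n j f" "j < n" "f \<in> E"
      using hk[OF F'] by (auto simp: essentially_unary_def)
    have arF: "arity F' = n" using hom_arity[OF hk(2)[OF F']] hk(1)[OF F'] F by simp
    have "\<forall>i<n. \<exists>B. finite B \<and> B \<subseteq> \<Omega> \<and>
        (\<forall>f\<in>E. \<forall>g\<in>E. (\<forall>b\<in>B. unary_action h g b = unary_action h f b) \<longrightarrow> g (as ! i) = f (as ! i))"
      using determined by blast
    then obtain X where X: "\<And>i. i < n \<Longrightarrow> finite (X i)" "\<And>i. i < n \<Longrightarrow> X i \<subseteq> \<Omega>"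
      "\<And>i f g. i < n \<Longrightarrow> f \<in> E \<Longrightarrow> g \<in> E \<Longrightarrow> (\<forall>b\<in>X i. unary_action h g b = unary_action h f b) \<Longrightarrow> g (as ! i) = f (as ! i)"
      by metis
    have "finite (\<Union>i<n. X i)" "(\<Union>i<n. X i) \<subseteq> \<Omega>" using X by blast+
    then obtain S where S: "finite S" "S \<subseteq> nlists n \<Omega>"
      "\<And>g i. i < n \<Longrightarrow> (\<And>xs. xs \<in> S \<Longrightarrow> g (xs ! i) = unary_action h f (xs ! j)) \<Longrightarrow>
        (\<forall>x\<in>(\<Union>i<n. X i). g x = unary_action h f x) \<and>
        (i = j \<or> (\<forall>x\<in>\<Omega>. \<forall>y\<in>\<Omega>. unary_action h f x = unary_action h f y))"
      using position_test[OF F(2), of "\<Union>i<n. X i" \<Omega> "unary_action h f"] by blast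
    have "app (k G') as = app (k F') as"
      if G': "G' \<in> Q" "arity G' = arity F'" "\<forall>xs\<in>S. app G' xs = app F' xs" for G'
    proof -
      have "arity (k G') = n" using hom_arity[OF hk(2)[OF G'(1)]] hk(1)[OF G'(1)] G'(2) arF by simp
      then obtain i g where g: "k G' = unary_at n i g" "i < n" "g \<in> E"
        using hk(2)[OF G'(1)] by (auto simp: essentially_unary_def)
      have "unary_action h g (xs ! i) = unary_action h f (xs ! j)" if "xs \<in> S" for xs
      proof -
        have xs: "xs \<in> nlists n \<Omega>" using that S by blast
        show ?thesis
          using hom_unary_at[OF g(3,2) xs] hom_unary_at[OF F(3,2) xs] G'(3) that hk(1)[OF G'(1)] hk(1)[OF F'] g F
          by metis
      qed
      note test = S(3)[OF g(2) this]
      have "g (as ! i) = f (as ! i)" using test g(2) by (intro X(3) F g) auto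
      moreover have "f (as ! i) = f (as ! j)"
      proof (cases "i = j")
        case False
        \<comment> \<open>Only the action is known to be constant; injectivity of \<open>h\<close>
          carries the equality back to the operations.\<close>
        have "unary_at n i f = unary_at n j f"
        proof (rule hom_ext)
          fix bs assume "bs \<in> nlists (arity (unary_at n i f)) \<Omega>"
          then have bs: "bs \<in> nlists n \<Omega>" by simp
          have "bs ! i \<in> \<Omega>" "bs ! j \<in> \<Omega>" using nlistsE_nth_in[OF bs] g F by blast+
          then have "unary_action h f (bs ! i) = unary_action h f (bs ! j)" using test False by blast
          then show "app (h (unary_at n i f)) bs = app (h (unary_at n j f)) bs"
            by (simp only: hom_unary_at[OF F(3) g(2) bs] hom_unary_at[OF F(3,2) bs])
        qed (use unary_at_in[OF F(3)] F(2) g(2) in simp_all)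
        then have "app (unary_at n i f) as = app (unary_at n j f) as" by simp
        then show ?thesis using as arF by (simp add: in_nlists_iff)
      qed simp
      ultimately show ?thesis using as arF g F by (simp add: in_nlists_iff)
    qed
    then show "\<exists>S. finite S \<and> S \<subseteq> nlists (arity F') \<Omega> \<and>
      (\<forall>G\<in>Q. arity G = arity F' \<longrightarrow> (\<forall>as\<in>S. app G as = app F' as) \<longrightarrow> app (k G) as = app (k F') as)"
      using S arF by auto
  qed
  ultimately show ?thesis
    unfolding homeomorphic_map_maps homeomorphic_maps_def using kh hk by auto
qed

end

context rat_action
begin

text \<open>
  Over a retraction \<open>p\<close> with \<open>p (\<theta> x y) = x\<close>, a monotone \<open>f\<close> factors as \<open>p\<close> after the strictly monotone
  map \<open>q \<mapsto> \<theta> (f q) q\<close>.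
\<close>

lemma mono_support:
  assumes mono_in: "\<And>f. mono f \<Longrightarrow> f \<in> Es" and b: "b \<in> \<Omega>"
  obtains F where "finite F"
    "\<And>f g. mono f \<Longrightarrow> mono g \<Longrightarrow> (\<And>p. p \<in> F \<Longrightarrow> f p = g p) \<Longrightarrow> act f b = act g b"
proof -
  obtain p :: "rat \<Rightarrow> rat" and \<theta> :: "rat \<Rightarrow> rat \<Rightarrow> rat" where p: "mono p" and p\<theta>: "\<forall>x y. p (\<theta> x y) = x"
    and \<theta>: "\<forall>x y x' y'. x < x' \<or> x = x' \<and> y < y' \<longrightarrow> \<theta> x y < \<theta> x' y'"
    using lexicographic_retraction by (elim exE conjE)
  obtain F where F: "finite F"
    "\<And>f g. strict_mono f \<Longrightarrow> strict_mono g \<Longrightarrow> (\<And>p. p \<in> F \<Longrightarrow> f p = g p) \<Longrightarrow> act f b = act g b"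
    using strict_support[OF b] by blast
  \<comment> \<open>The second coordinate breaks ties of \<open>f\<close>, and
    \<open>lift f q\<close> depends on \<open>f\<close> only through \<open>f q\<close>, so lifts
    agree wherever the maps do.\<close>
  define lift where "lift f q = \<theta> (f q) q" for f q
  have lift: "strict_mono (lift f)" if "mono f" for f
  proof (rule strict_monoI)
    fix x y :: rat assume "x < y"
    then have "f x \<le> f y" using that by (simp add: monoD)
    then show "lift f x < lift f y" unfolding lift_def using \<theta> \<open>x < y\<close> by (metis le_less)
  qed
  have act_lift: "act f b = act p (act (lift f) b)" if "mono f" for f
  proof -
    have "p \<circ> lift f = f" by (auto simp: lift_def p\<theta>)
    then show ?thesis using act_comp[OF mono_in[OF p] strict_in[OF lift[OF that]] b] by simp
  qed
  show thesis
  proof (rule that[OF F(1)])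
    fix f g :: "rat \<Rightarrow> rat" assume fg: "mono f" "mono g" "\<And>p. p \<in> F \<Longrightarrow> f p = g p"
    then have "act (lift f) b = act (lift g) b"
      by (intro F(2) lift) (simp_all add: lift_def)
    then show "act f b = act g b" using fg act_lift by simp
  qed
qed

text \<open>
  The action of constants yields a map from the rationals to \<open>\<Omega>\<close> for each point, and if this map is not
  constant, then it is injective since all pairs \<open>x < y\<close> are images of each other under \<open>Es\<close>.
\<close>

lemma mono_determined:
  assumes mono_in: "\<And>f. mono f \<Longrightarrow> f \<in> Es"
  obtains B where "finite B" "B \<subseteq> \<Omega>"
    "\<And>f g. f \<in> Es \<Longrightarrow> g \<in> Es \<Longrightarrow> (\<And>b. b \<in> B \<Longrightarrow> act f b = act g b) \<Longrightarrow> f q = g q"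
proof -
  define c where "c x = (\<lambda>_ :: rat. x)" for x :: rat
  have c: "c x \<in> Es" for x by (rule mono_in) (simp add: c_def mono_def)
  have comp_c: "act f (act (c x) b) = act (c (f x)) b" if "f \<in> Es" "b \<in> \<Omega>" for f x b
    using act_comp[OF that(1) c that(2), of x] by (simp add: c_def o_def)
  have "c 0 \<noteq> c 1" by (auto simp: c_def fun_eq_iff)
  then obtain b where b: "b \<in> \<Omega>" "act (c 0) b \<noteq> act (c 1) b" using act_faithful[OF c c] by blast
  have distinct: "act (c x) b \<noteq> act (c y) b" if "x < y" for x y
  proof
    assume eq: "act (c x) b = act (c y) b"
    \<comment> \<open>This affine map sends \<open>x\<close> to 0 and \<open>y\<close> to 1, so a
      collision at \<open>x\<close>, \<open>y\<close> would give one at 0, 1.\<close>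
    define s where "s z = (z - x) / (y - x)" for z
    have "strict_mono s" using that by (auto simp: strict_mono_def s_def divide_strict_right_mono)
    then have "act (c (s x)) b = act (c (s y)) b"
      using comp_c[OF strict_in b(1)] eq by metis
    then show False using b(2) that by (simp add: s_def)
  qed
  show thesis
  proof (rule that)
    show "finite {act (c q) b}" "{act (c q) b} \<subseteq> \<Omega>" using act_in[OF c b(1)] by auto
    fix f g assume fg: "f \<in> Es" "g \<in> Es" "\<And>d. d \<in> {act (c q) b} \<Longrightarrow> act f d = act g d"
    then have "act (c (f q)) b = act (c (g q)) b" using comp_c b(1) by (metis singletonI)
    then show "f q = g q" using distinct by (metis linorder_cases)
  qed
qed

end

text \<open>The passage through clones is common to both monoids; they differ only in the proofs of
  \<open>support\<close> and \<open>determined\<close>.\<close>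

lemma automatic_homeomorphicity_generated_clone:
  fixes E :: "(rat \<Rightarrow> rat) set"
  assumes comp: "\<And>f g. f \<in> E \<Longrightarrow> g \<in> E \<Longrightarrow> f \<circ> g \<in> E"
    and strict: "\<And>f. strict_mono f \<Longrightarrow> f \<in> E"
    and closed: "\<And>t. (\<And>F. finite F \<Longrightarrow> \<exists>f\<in>E. \<forall>x\<in>F. f x = t x) \<Longrightarrow> t \<in> E"
    and support: "\<And>(\<Omega> :: 'b set) act b. rat_action E \<Omega> act \<Longrightarrow> b \<in> \<Omega> \<Longrightarrow>
      \<exists>F. finite F \<and> (\<forall>f\<in>E. \<forall>g\<in>E. (\<forall>x\<in>F. g x = f x) \<longrightarrow> act g b = act f b)"
    and determined: "\<And>(\<Omega> :: 'b set) act q. rat_action E \<Omega> act \<Longrightarrow>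
      \<exists>B. finite B \<and> B \<subseteq> \<Omega> \<and> (\<forall>f\<in>E. \<forall>g\<in>E. (\<forall>b\<in>B. act g b = act f b) \<longrightarrow> g q = f q)"
  shows "automatic_homeomorphicity TYPE('b) UNIV (generated_clone UNIV E)"
proof -
  have id: "id \<in> E" by (rule strict) (simp add: strict_mono_def)
  have gen: "generated_clone UNIV E = essentially_unary E"
    using id comp by (rule generated_clone_eq)
  have "homeomorphic_map (clone_topology UNIV (essentially_unary E)) (clone_topology \<Omega> Q) h"
    if "countable \<Omega>" and Q: "closed_clone \<Omega> Q" and iso: "clone_iso UNIV (essentially_unary E) \<Omega> Q h"
    for \<Omega> :: "'b set" and Q h
  proof -
    note ctxt = id comp Q iso
    have action: "rat_action E \<Omega> (unary_action h)"
    proof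
      show "unary_action h (f \<circ> g) b = unary_action h f (unary_action h g b)"
        if "f \<in> E" "g \<in> E" "b \<in> \<Omega>" for f g b by (rule unary_action_comp[OF ctxt that])
      show "unary_action h f b \<in> \<Omega>" if "f \<in> E" "b \<in> \<Omega>" for f b
        by (rule unary_action_in[OF ctxt that])
      show "f = g" if "f \<in> E" "g \<in> E" "\<And>b. b \<in> \<Omega> \<Longrightarrow> unary_action h f b = unary_action h g b" for f g
        by (rule unary_action_faithful[OF ctxt that])
      show "\<exists>f\<in>E. \<forall>b\<in>\<Omega>. unary_action h f b = t b"
        if "\<And>B. finite B \<Longrightarrow> B \<subseteq> \<Omega> \<Longrightarrow> \<exists>f\<in>E. \<forall>b\<in>B. unary_action h f b = t b" for t
        by (rule unary_action_closed[OF ctxt that])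
    qed (use strict comp \<open>countable \<Omega>\<close> in auto)
    then interpret rat_action E \<Omega> "unary_action h" .
    \<comment> \<open>On an empty carrier all maps act equally, so a translation would equal the
      identity.\<close>
    have "\<Omega> \<noteq> {}"
    proof
      assume "\<Omega> = {}"
      then have "id = (\<lambda>x :: rat. x + 1)"
        by (intro act_faithful strict) (auto simp: strict_mono_def)
      then show False by (auto simp: fun_eq_iff)
    qed
    then show ?thesis
      using support[OF action] determined[OF action]
      by (intro homeomorphic_map_of_unary_action[OF ctxt])
  qed
  then show ?thesis
    using closed_clone_essentially_unary[OF id comp closed]
    unfolding automatic_homeomorphicity_def gen by auto
qed

theorem corollary6p6:
  shows "automatic_homeomorphicity TYPE('b) (UNIV :: rat set)
           (generated_clone UNIV {f :: rat \<Rightarrow> rat. strict_mono f})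
       \<and> automatic_homeomorphicity TYPE('b) (UNIV :: rat set)
           (generated_clone UNIV {f :: rat \<Rightarrow> rat. mono f})"
proof
  show "automatic_homeomorphicity TYPE('b) (UNIV :: rat set) (generated_clone UNIV {f :: rat \<Rightarrow> rat. strict_mono f})"
  proof (rule automatic_homeomorphicity_generated_clone)
    fix t :: "rat \<Rightarrow> rat"
    assume approx: "\<And>F. finite F \<Longrightarrow> \<exists>f\<in>{f. strict_mono f}. \<forall>x\<in>F. f x = t x"
    have "t x < t y" if "x < y" for x y
    proof -
      \<comment> \<open>Strict monotonicity is a condition on pairs, so two-point sets suffice for
        closedness.\<close>
      obtain f where "strict_mono f" "f x = t x" "f y = t y" using approx[of "{x, y}"] by auto
      then show ?thesis using that by (metis strict_mono_less)
    qed
    then show "t \<in> {f. strict_mono f}" by (simp add: strict_mono_def)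
  next
    fix \<Omega> :: "'b set" and act b
    assume act: "rat_action {f. strict_mono f} \<Omega> act" and b: "b \<in> \<Omega>"
    show "\<exists>F. finite F \<and> (\<forall>f\<in>{f. strict_mono f}. \<forall>g\<in>{f. strict_mono f}.
        (\<forall>x\<in>F. g x = f x) \<longrightarrow> act g b = act f b)"
    proof (rule rat_action.strict_support[OF act b])
      fix F assume "finite F" and F: "\<And>f g. strict_mono f \<Longrightarrow> strict_mono g \<Longrightarrow>
        (\<And>p. p \<in> F \<Longrightarrow> f p = g p) \<Longrightarrow> act f b = act g b"
      then show ?thesis by (intro exI[of _ F] conjI ballI impI F) auto
    qed
  next
    fix \<Omega> :: "'b set" and act q
    assume act: "rat_action {f. strict_mono f} \<Omega> act"
    show "\<exists>B. finite B \<and> B \<subseteq> \<Omega> \<and> (\<forall>f\<in>{f. strict_mono f}. \<forall>g\<in>{f. strict_mono f}.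
        (\<forall>b\<in>B. act g b = act f b) \<longrightarrow> g q = f q)"
    proof (rule rat_action.strict_determined[OF act, where q = q])
      fix B assume "finite B" "B \<subseteq> \<Omega>" and B: "\<And>f g. strict_mono f \<Longrightarrow> strict_mono g \<Longrightarrow>
        (\<And>b. b \<in> B \<Longrightarrow> act f b = act g b) \<Longrightarrow> f q = g q"
      then show ?thesis by (intro exI[of _ B] conjI ballI impI B) auto
    qed
  qed (auto simp: strict_mono_o)
  show "automatic_homeomorphicity TYPE('b) (UNIV :: rat set) (generated_clone UNIV {f :: rat \<Rightarrow> rat. mono f})"
  proof (rule automatic_homeomorphicity_generated_clone)
    fix t :: "rat \<Rightarrow> rat"
    assume approx: "\<And>F. finite F \<Longrightarrow> \<exists>f\<in>{f. mono f}. \<forall>x\<in>F. f x = t x"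
    have "t x \<le> t y" if "x \<le> y" for x y
    proof -
      obtain f where "mono f" "f x = t x" "f y = t y" using approx[of "{x, y}"] by auto
      then show ?thesis using that by (metis monoD)
    qed
    then show "t \<in> {f. mono f}" by (simp add: mono_def)
  next
    fix \<Omega> :: "'b set" and act b
    assume act: "rat_action {f. mono f} \<Omega> act" and b: "b \<in> \<Omega>"
    show "\<exists>F. finite F \<and> (\<forall>f\<in>{f. mono f}. \<forall>g\<in>{f. mono f}.
        (\<forall>x\<in>F. g x = f x) \<longrightarrow> act g b = act f b)"
    proof (rule rat_action.mono_support[OF act _ b])
      fix F assume "finite F" and F: "\<And>f g. mono f \<Longrightarrow> mono g \<Longrightarrow>
        (\<And>p. p \<in> F \<Longrightarrow> f p = g p) \<Longrightarrow> act f b = act g b"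
      then show ?thesis by (intro exI[of _ F] conjI ballI impI F) auto
    qed simp
  next
    fix \<Omega> :: "'b set" and act q
    assume act: "rat_action {f. mono f} \<Omega> act"
    show "\<exists>B. finite B \<and> B \<subseteq> \<Omega> \<and> (\<forall>f\<in>{f. mono f}. \<forall>g\<in>{f. mono f}.
        (\<forall>b\<in>B. act g b = act f b) \<longrightarrow> g q = f q)"
    proof (rule rat_action.mono_determined[OF act, where q = q])
      fix B assume "finite B" "B \<subseteq> \<Omega>" and B: "\<And>f g. f \<in> {f. mono f} \<Longrightarrow> g \<in> {f. mono f} \<Longrightarrow>
        (\<And>b. b \<in> B \<Longrightarrow> act f b = act g b) \<Longrightarrow> f q = g q"
      then show ?thesis by (intro exI[of _ B] conjI ballI impI B) auto
    qed simp
  next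
    show "f \<circ> g \<in> {f. mono f}" if "f \<in> {f. mono f}" "g \<in> {f. mono f}" for f g :: "rat \<Rightarrow> rat"
      using that by (auto simp: mono_def)
  qed (auto simp: strict_mono_mono)
qed

end
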